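(* Let $\epsilon\in\{-1,1\}$ and let $(M,g,J)$ be a connected and simply-connected non-flat $\epsilon$-Kähler manifold of dimension $2n+4$, $n\geq0$, admitting a degenerate homogeneous $\epsilon$-Kähler structure of linear type with $\zeta=-\frac{\epsilon}{2}\xi$. Then $(M,g,J)$ is not geodesically complete.
   Context: Let $\epsilon\in\{-1,1\}$. An $\epsilon$-Kähler manifold $(M,g,J)$ is a pseudo-Riemannian manifold $(M,g)$ of even dimension with a smooth section $J$ of $\mathfrak{so}(TM)$ (i.e. $J$ is $g$-skew-symmetric) such that $J^2=\epsilon\,\mathrm{Id}$ and $\nabla J=0$, $\nabla$ being the Levi-Civita connection. A homogeneous $\epsilon$-Kähler structure is a $(1,2)$-tensor field $S$ such that $\widetilde\nabla=\nabla-S$ satisfies $\widetilde\nabla g=0$, $\widetilde\nabla R=0$, $\widetilde\nabla S=0$, $\widetilde\nabla J=0$, where $R$ is the curvature tensor of $g$. It is of linear type if $$S_XY=g(X,Y)\xi-g(\xi,Y)X+\epsilon g(X,JY)J\xi-\epsilon g(\xi,JY)JX-2g(\zeta,JX)JY$$ for some vector fields $\xi,\zeta$ on $M$; such an $S$ is degenerate if $\xi\neq0$ and $g(\xi,\xi)=0$. *)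

theory Defs
  imports "HOL-Analysis.Analysis"
begin

text \<open>
  Smooth manifolds modelled on a Euclidean space, with classical tensor calculus. A manifold is a
  Hausdorff, second countable type \<^typ>\<open>'a\<close> together with a smooth atlas, modelled on \<^typ>\<open>'e\<close>. A tensor
  field is given by its components in each chart of the atlas, subject to the tensorial
  transformation law on overlaps; the components are recorded as multilinear maps on \<^typ>\<open>'e\<close>, where
  a vector \<open>u\<close> of \<^typ>\<open>'e\<close> stands for the coordinate vector field of the chart with constant
  components \<open>u\<close>. Components are functions of the point of the manifold, and they are
  meaningful only at points of the domain of the chart.
\<close>

section \<open>Smooth functions\<close>

primrec iterated_deriv ::
  "('e::real_normed_vector \<Rightarrow> 'f::real_normed_vector) \<Rightarrow> 'e list \<Rightarrow> 'e \<Rightarrow> 'f" where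
  "iterated_deriv f [] = f"
| "iterated_deriv f (v # vs) = (\<lambda>x. frechet_derivative (iterated_deriv f vs) (at x) v)"

text \<open>Smoothness on an open set: all iterated directional derivatives exist and are differentiable
  (hence continuous) there. It is only used for open sets.\<close>

definition smooth_on ::
  "'e::real_normed_vector set \<Rightarrow> ('e \<Rightarrow> 'f::real_normed_vector) \<Rightarrow> bool" where
  "smooth_on D f \<longleftrightarrow> (\<forall>vs. \<forall>x\<in>D. iterated_deriv f vs differentiable (at x))"

section \<open>Atlases\<close>

text \<open>A chart consists of its domain and its coordinate map; the values of the latter outside the
  domain are irrelevant.\<close>

type_synonym ('a, 'e) chart = "'a set \<times> ('a \<Rightarrow> 'e)"

definition chart_inv :: "('a, 'e) chart \<Rightarrow> 'e \<Rightarrow> 'a" where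
  "chart_inv c = inv_into (fst c) (snd c)"

definition is_chart :: "('a::topological_space, 'e::euclidean_space) chart \<Rightarrow> bool" where
  "is_chart c \<longleftrightarrow> open (fst c) \<and> open (snd c ` fst c) \<and>
     homeomorphism (fst c) (snd c ` fst c) (snd c) (chart_inv c)"

definition smooth_atlas :: "('a::topological_space, 'e::euclidean_space) chart set \<Rightarrow> bool" where
  "smooth_atlas A \<longleftrightarrow>
     (\<forall>c\<in>A. is_chart c) \<and> (\<Union>c\<in>A. fst c) = UNIV \<and>
     (\<forall>c\<in>A. \<forall>d\<in>A. smooth_on (snd c ` (fst c \<inter> fst d)) (snd d \<circ> chart_inv c))"

definition jacobian ::
  "('a, 'e::euclidean_space) chart \<Rightarrow> ('a, 'e) chart \<Rightarrow> 'a \<Rightarrow> 'e \<Rightarrow> 'e" where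
  "jacobian c d p = frechet_derivative (snd d \<circ> chart_inv c) (at (snd c p))"

definition smooth_in_chart ::
  "('a, 'e::euclidean_space) chart \<Rightarrow> ('a \<Rightarrow> 'f::real_normed_vector) \<Rightarrow> bool" where
  "smooth_in_chart c f \<longleftrightarrow> smooth_on (snd c ` fst c) (f \<circ> chart_inv c)"

text \<open>Derivative at \<open>p\<close> of a function on the manifold along the coordinate vector field \<open>u\<close> of \<open>c\<close>.\<close>

definition coord_deriv ::
  "('a, 'e::euclidean_space) chart \<Rightarrow> 'e \<Rightarrow> ('a \<Rightarrow> 'f::real_normed_vector) \<Rightarrow> 'a \<Rightarrow> 'f" where
  "coord_deriv c u f p = frechet_derivative (f \<circ> chart_inv c) (at (snd c p)) u"

section \<open>Tensor fields\<close>

type_synonym ('a, 'e) vfield = "('a, 'e) chart \<Rightarrow> 'a \<Rightarrow> 'e"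
type_synonym ('a, 'e) tensor02 = "('a, 'e) chart \<Rightarrow> 'a \<Rightarrow> 'e \<Rightarrow> 'e \<Rightarrow> real"
type_synonym ('a, 'e) tensor11 = "('a, 'e) chart \<Rightarrow> 'a \<Rightarrow> 'e \<Rightarrow> 'e"
type_synonym ('a, 'e) tensor12 = "('a, 'e) chart \<Rightarrow> 'a \<Rightarrow> 'e \<Rightarrow> 'e \<Rightarrow> 'e"

definition vector_field :: "('a, 'e::euclidean_space) chart set \<Rightarrow> ('a, 'e) vfield \<Rightarrow> bool" where
  "vector_field A X \<longleftrightarrow>
     (\<forall>c\<in>A. smooth_in_chart c (X c)) \<and>
     (\<forall>c\<in>A. \<forall>d\<in>A. \<forall>p\<in>fst c \<inter> fst d. X d p = jacobian c d p (X c p))"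

definition tensor_field_02 ::
  "('a, 'e::euclidean_space) chart set \<Rightarrow> ('a, 'e) tensor02 \<Rightarrow> bool" where
  "tensor_field_02 A T \<longleftrightarrow>
     (\<forall>c\<in>A. \<forall>p\<in>fst c. bilinear (T c p)) \<and>
     (\<forall>c\<in>A. \<forall>u v. smooth_in_chart c (\<lambda>p. T c p u v)) \<and>
     (\<forall>c\<in>A. \<forall>d\<in>A. \<forall>p\<in>fst c \<inter> fst d. \<forall>u v.
        T d p (jacobian c d p u) (jacobian c d p v) = T c p u v)"

definition tensor_field_11 ::
  "('a, 'e::euclidean_space) chart set \<Rightarrow> ('a, 'e) tensor11 \<Rightarrow> bool" where
  "tensor_field_11 A T \<longleftrightarrow>
     (\<forall>c\<in>A. \<forall>p\<in>fst c. linear (T c p)) \<and>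
     (\<forall>c\<in>A. \<forall>u. smooth_in_chart c (\<lambda>p. T c p u)) \<and>
     (\<forall>c\<in>A. \<forall>d\<in>A. \<forall>p\<in>fst c \<inter> fst d. \<forall>u.
        T d p (jacobian c d p u) = jacobian c d p (T c p u))"

definition tensor_field_12 ::
  "('a, 'e::euclidean_space) chart set \<Rightarrow> ('a, 'e) tensor12 \<Rightarrow> bool" where
  "tensor_field_12 A T \<longleftrightarrow>
     (\<forall>c\<in>A. \<forall>p\<in>fst c. bilinear (T c p)) \<and>
     (\<forall>c\<in>A. \<forall>u v. smooth_in_chart c (\<lambda>p. T c p u v)) \<and>
     (\<forall>c\<in>A. \<forall>d\<in>A. \<forall>p\<in>fst c \<inter> fst d. \<forall>u v.
        T d p (jacobian c d p u) (jacobian c d p v) = jacobian c d p (T c p u v))"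

section \<open>Pseudo-Riemannian metrics and covariant derivatives\<close>

definition pseudo_riemannian_metric ::
  "('a, 'e::euclidean_space) chart set \<Rightarrow> ('a, 'e) tensor02 \<Rightarrow> bool" where
  "pseudo_riemannian_metric A g \<longleftrightarrow>
     tensor_field_02 A g \<and>
     (\<forall>c\<in>A. \<forall>p\<in>fst c.
        (\<forall>u v. g c p u v = g c p v u) \<and> (\<forall>u. (\<forall>v. g c p u v = 0) \<longrightarrow> u = 0))"

text \<open>The Levi-Civita connection: \<open>christoffel g c p u v\<close> is the value at \<open>p\<close> of the covariant derivative
  of the coordinate field \<open>v\<close> along \<open>u\<close>. It is given by the Koszul formula, whose bracket terms vanish
  for coordinate fields.\<close>

definition christoffel :: "('a, 'e::euclidean_space) tensor02 \<Rightarrow> ('a, 'e) tensor12" where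
  "christoffel g c p u v =
     (THE z. \<forall>w. 2 * g c p z w =
        coord_deriv c u (\<lambda>q. g c q v w) p + coord_deriv c v (\<lambda>q. g c q u w) p
          - coord_deriv c w (\<lambda>q. g c q u v) p)"

text \<open>\<open>riemann g c p u v w\<close> is \<open>R(u,v)w\<close>.\<close>

definition riemann ::
  "('a, 'e::euclidean_space) tensor02 \<Rightarrow> ('a, 'e) chart \<Rightarrow> 'a \<Rightarrow> 'e \<Rightarrow> 'e \<Rightarrow> 'e \<Rightarrow> 'e" where
  "riemann g c p u v w =
     (let \<Gamma> = christoffel g c in
      coord_deriv c u (\<lambda>q. \<Gamma> q v w) p - coord_deriv c v (\<lambda>q. \<Gamma> q u w) p
        + \<Gamma> p u (\<Gamma> p v w) - \<Gamma> p v (\<Gamma> p u w))"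

definition flat :: "('a, 'e::euclidean_space) chart set \<Rightarrow> ('a, 'e) tensor02 \<Rightarrow> bool" where
  "flat A g \<longleftrightarrow> (\<forall>c\<in>A. \<forall>p\<in>fst c. \<forall>u v w. riemann g c p u v w = 0)"

text \<open>Vanishing of the covariant derivative of a tensor field with respect to the connection whose
  coefficients, in the sense of \<^const>\<open>christoffel\<close>, are \<open>C\<close>.\<close>

definition parallel_02 ::
  "('a, 'e::euclidean_space) chart set \<Rightarrow> ('a, 'e) tensor12 \<Rightarrow> ('a, 'e) tensor02 \<Rightarrow> bool" where
  "parallel_02 A C T \<longleftrightarrow>
     (\<forall>c\<in>A. \<forall>p\<in>fst c. \<forall>u v w.
        coord_deriv c u (\<lambda>q. T c q v w) p - T c p (C c p u v) w - T c p v (C c p u w) = 0)"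

definition parallel_11 ::
  "('a, 'e::euclidean_space) chart set \<Rightarrow> ('a, 'e) tensor12 \<Rightarrow> ('a, 'e) tensor11 \<Rightarrow> bool" where
  "parallel_11 A C T \<longleftrightarrow>
     (\<forall>c\<in>A. \<forall>p\<in>fst c. \<forall>u v.
        coord_deriv c u (\<lambda>q. T c q v) p + C c p u (T c p v) - T c p (C c p u v) = 0)"

definition parallel_12 ::
  "('a, 'e::euclidean_space) chart set \<Rightarrow> ('a, 'e) tensor12 \<Rightarrow> ('a, 'e) tensor12 \<Rightarrow> bool" where
  "parallel_12 A C T \<longleftrightarrow>
     (\<forall>c\<in>A. \<forall>p\<in>fst c. \<forall>u v w.
        coord_deriv c u (\<lambda>q. T c q v w) p + C c p u (T c p v w)
          - T c p (C c p u v) w - T c p v (C c p u w) = 0)"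

definition parallel_13 ::
  "('a, 'e::euclidean_space) chart set \<Rightarrow> ('a, 'e) tensor12
    \<Rightarrow> (('a, 'e) chart \<Rightarrow> 'a \<Rightarrow> 'e \<Rightarrow> 'e \<Rightarrow> 'e \<Rightarrow> 'e) \<Rightarrow> bool" where
  "parallel_13 A C T \<longleftrightarrow>
     (\<forall>c\<in>A. \<forall>p\<in>fst c. \<forall>u v w z.
        coord_deriv c u (\<lambda>q. T c q v w z) p + C c p u (T c p v w z)
          - T c p (C c p u v) w z - T c p v (C c p u w) z - T c p v w (C c p u z) = 0)"

section \<open>Homogeneous epsilon-Kaehler structures\<close>

definition eps_kaehler_manifold ::
  "real \<Rightarrow> ('a::{t2_space, second_countable_topology}, 'e::euclidean_space) chart set
    \<Rightarrow> ('a, 'e) tensor02 \<Rightarrow> ('a, 'e) tensor11 \<Rightarrow> bool" where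
  "eps_kaehler_manifold \<epsilon> A g J \<longleftrightarrow>
     smooth_atlas A \<and> even DIM('e) \<and> pseudo_riemannian_metric A g \<and> tensor_field_11 A J \<and>
     (\<forall>c\<in>A. \<forall>p\<in>fst c. \<forall>u v. g c p (J c p u) v = - g c p u (J c p v)) \<and>
     (\<forall>c\<in>A. \<forall>p\<in>fst c. \<forall>u. J c p (J c p u) = \<epsilon> *\<^sub>R u) \<and>
     parallel_11 A (christoffel g) J"

definition homogeneous_eps_kaehler_structure ::
  "('a, 'e::euclidean_space) chart set \<Rightarrow> ('a, 'e) tensor02 \<Rightarrow> ('a, 'e) tensor11
    \<Rightarrow> ('a, 'e) tensor12 \<Rightarrow> bool" where
  "homogeneous_eps_kaehler_structure A g J S \<longleftrightarrow>
     tensor_field_12 A S \<and>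
     (let C = (\<lambda>c p u v. christoffel g c p u v - S c p u v) in
        parallel_02 A C g \<and> parallel_13 A C (riemann g) \<and> parallel_12 A C S \<and> parallel_11 A C J)"

definition linear_type ::
  "real \<Rightarrow> ('a, 'e::euclidean_space) chart set \<Rightarrow> ('a, 'e) tensor02 \<Rightarrow> ('a, 'e) tensor11
    \<Rightarrow> ('a, 'e) tensor12 \<Rightarrow> ('a, 'e) vfield \<Rightarrow> ('a, 'e) vfield \<Rightarrow> bool" where
  "linear_type \<epsilon> A g J S \<xi> \<zeta> \<longleftrightarrow>
     vector_field A \<xi> \<and> vector_field A \<zeta> \<and>
     (\<forall>c\<in>A. \<forall>p\<in>fst c. \<forall>X Y.
        S c p X Y =
          g c p X Y *\<^sub>R \<xi> c p - g c p (\<xi> c p) Y *\<^sub>R X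
          + (\<epsilon> * g c p X (J c p Y)) *\<^sub>R J c p (\<xi> c p)
          - (\<epsilon> * g c p (\<xi> c p) (J c p Y)) *\<^sub>R J c p X
          - (2 * g c p (\<zeta> c p) (J c p X)) *\<^sub>R J c p Y)"

text \<open>Here \<open>\<xi> \<noteq> 0\<close> means that \<open>\<xi>\<close> is not the zero vector field.\<close>

definition degenerate ::
  "('a, 'e::euclidean_space) chart set \<Rightarrow> ('a, 'e) tensor02 \<Rightarrow> ('a, 'e) vfield \<Rightarrow> bool" where
  "degenerate A g \<xi> \<longleftrightarrow>
     (\<exists>c\<in>A. \<exists>p\<in>fst c. \<xi> c p \<noteq> 0) \<and> (\<forall>c\<in>A. \<forall>p\<in>fst c. g c p (\<xi> c p) (\<xi> c p) = 0)"

section \<open>Geodesics\<close>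

text \<open>The geodesic equation is imposed in some chart around each point of the curve; by
  tensoriality of the acceleration it then holds in every chart. In that chart \<open>v\<close> is the velocity.
  The definition is only used for open \<open>I\<close>; geodesics are then automatically smooth.\<close>

definition geodesic_on ::
  "('a, 'e::euclidean_space) chart set \<Rightarrow> ('a, 'e) tensor02 \<Rightarrow> real set \<Rightarrow> (real \<Rightarrow> 'a) \<Rightarrow> bool" where
  "geodesic_on A g I \<gamma> \<longleftrightarrow>
     (\<forall>t\<in>I. \<exists>c\<in>A. \<exists>v.
        (\<forall>\<^sub>F s in nhds t. \<gamma> s \<in> fst c \<and> ((snd c \<circ> \<gamma>) has_vector_derivative v s) (at s)) \<and>
        (v has_vector_derivative - christoffel g c (\<gamma> t) (v t) (v t)) (at t))"

definition geodesically_complete ::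
  "('a, 'e::euclidean_space) chart set \<Rightarrow> ('a, 'e) tensor02 \<Rightarrow> bool" where
  "geodesically_complete A g \<longleftrightarrow>
     (\<forall>I \<gamma>. open I \<and> is_interval I \<and> I \<noteq> {} \<and> geodesic_on A g I \<gamma> \<longrightarrow>
        (\<exists>\<sigma>. geodesic_on A g UNIV \<sigma> \<and> (\<forall>t\<in>I. \<sigma> t = \<gamma> t)))"

end

theory Submission
  imports Defs
begin

text \<open>
  On the diagonal the structure is \<open>S X X = g(X,X) \<xi> - g(\<xi>,X) X\<close>, because \<open>\<zeta> = -(\<epsilon>/2) \<xi>\<close> cancels
  the terms in \<open>J\<close>. Being parallel for \<open>\<nabla> - S\<close>, it forces \<open>\<eta> = (\<nabla> - S)\<^sub>u \<xi>\<close> to satisfy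
  \<open>g(X,X) \<eta> = g(\<eta>,X) X\<close> for all \<open>X\<close>, hence \<open>\<eta> = 0\<close>; since \<open>\<xi>\<close> is null this reads
  \<open>\<nabla>\<^sub>X \<xi> = g(X,\<xi>) \<xi>\<close>. Along a geodesic \<open>\<gamma>\<close> the function \<open>f = g(\<xi>,\<gamma>')\<close> therefore solves the Riccati
  equation \<open>f' = f\<^sup>2\<close>, whose nonzero solutions blow up in finite time, and a geodesic with \<open>f \<noteq> 0\<close>
  starts at every point where \<open>\<xi> \<noteq> 0\<close>.
\<close>

text \<open>Completeness speaks of extending geodesics, so a contradiction needs one actual geodesic
  with g(\<xi>,\<gamma>') nonzero. Picard iteration for the geodesic spray in a single chart
  produces it. The obstacle is regularity: \<open>christoffel\<close> is only the unique solution of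
  the Koszul equation, so the spray is not visibly smooth. Local Lipschitz continuity is what the
  iteration asks for, and it can be read off from that linear equation. The extended geodesic
  wanders through many charts, each with its own velocity function; the Riccati argument becomes
  global because g(\<xi>,\<gamma>') does not depend on the chart. Passing from g(X,X) \<eta> =
  g(\<eta>,X) X to \<eta> = 0 uses J \<eta> as a vector orthogonal to \<eta>: in dimension one the
  identity would hold for every \<eta>.\<close>

section \<open>Ordinary differential equations\<close>

text \<open>Truncation replaces \<open>F\<close> by \<open>H\<close>, its composition with the
  nearest-point projection onto the ball. \<open>H\<close> is bounded and Lipschitz on the whole
  space, so the Picard operator acts on all bounded continuous functions and no iterate has to be
  kept in the ball. The bound on \<open>H\<close> then puts the fixed point back into the ball,
  where \<open>H\<close> and \<open>F\<close> agree.\<close>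

lemma picard_local_existence:
  fixes F :: "'b::euclidean_space \<Rightarrow> 'b"
  assumes lip: "L-lipschitz_on (cball y0 r) F" and r: "r > 0"
  obtains h y where "h > 0"
    "\<And>t. t \<in> {0<..<h} \<Longrightarrow> (y has_vector_derivative F (y t)) (at t)"
    "\<And>t. t \<in> {0<..<h} \<Longrightarrow> y t \<in> cball y0 r"
proof -
  define P where "P = closest_point (cball y0 r)"
  define H where "H = F \<circ> P"
  have L0: "0 \<le> L" using lip lipschitz_on_nonneg by blast
  have P_in: "P x \<in> cball y0 r" for x
    unfolding P_def using r by (intro closest_point_in_set) auto
  have P_id: "P x = x" if "x \<in> cball y0 r" for x
    unfolding P_def using that by (rule closest_point_self)
  have P_lip: "dist (P x) (P y) \<le> dist x y" for x y
    unfolding P_def using r by (intro closest_point_lipschitz) auto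
  have H_lip: "dist (H x) (H y) \<le> L * dist x y" for x y
  proof -
    have "dist (H x) (H y) \<le> L * dist (P x) (P y)"
      unfolding H_def o_def by (rule lipschitz_onD[OF lip P_in P_in])
    also have "\<dots> \<le> L * dist x y" using P_lip L0 by (rule mult_left_mono)
    finally show ?thesis .
  qed
  have H_cont: "continuous_on UNIV H"
    by (rule lipschitz_on_continuous_on[of L]) (auto intro!: lipschitz_onI H_lip L0)
  define M where "M = norm (F y0) + L * r"
  have M0: "0 \<le> M" unfolding M_def using L0 r by simp
  have H_bound: "norm (H x) \<le> M" for x
  proof -
    have "dist (F (P x)) (F y0) \<le> L * dist (P x) y0"
      using r by (intro lipschitz_onD[OF lip P_in]) auto
    also have "\<dots> \<le> L * r"
      using P_in[of x] L0 by (intro mult_left_mono) (auto simp: dist_commute)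
    finally show ?thesis
      unfolding M_def H_def o_def dist_norm
      using norm_triangle_sub[of "F (P x)" "F y0"] by linarith
  qed
  \<comment> \<open>The first bound gives contraction factor 1/2, the second keeps the solution
    within distance \<open>r\<close> of \<open>y0\<close>. Adding 1 avoids division by zero for
    \<open>L = 0\<close> or \<open>M = 0\<close>.\<close>
  define h where "h = min (1 / (2 * (L + 1))) (r / (M + 1))"
  have h0: "h > 0" unfolding h_def using L0 M0 r by auto
  have hL: "L * h \<le> 1 / 2"
  proof -
    have "L * h \<le> L * (1 / (2 * (L + 1)))"
      using L0 by (intro mult_left_mono) (auto simp: h_def)
    also have "\<dots> \<le> 1 / 2" using L0 by (simp add: field_simps)
    finally show ?thesis .
  qed
  have hM: "M * h \<le> r"
  proof -
    have "M * h \<le> M * (r / (M + 1))"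
      using M0 by (intro mult_left_mono) (auto simp: h_def)
    also have "\<dots> \<le> r" using M0 r by (simp add: field_simps)
    finally show ?thesis .
  qed
  \<comment> \<open>Clamping time to [0,h] extends the integrals constantly to the whole line, so
    that \<open>\<Phi>\<close> maps the complete space of bounded continuous functions on the reals
    to itself.\<close>
  define c where "c t = max 0 (min h t)" for t :: real
  have c_in: "c t \<in> {0..h}" for t using h0 by (auto simp: c_def)
  have Hf_cont: "continuous_on T (\<lambda>s. H (apply_bcontfun f s))"
    for f :: "real \<Rightarrow>\<^sub>C 'b" and T
    by (rule continuous_on_compose2[OF H_cont]) auto
  define \<Phi> where
    "\<Phi> f = Bcontfun (\<lambda>t. y0 + integral {0..c t} (\<lambda>s. H (apply_bcontfun f s)))" for f
  have bound: "norm (integral {0..c t} (\<lambda>s. H (apply_bcontfun f s))) \<le> M * h" for f t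
  proof -
    have "norm (integral {0..c t} (\<lambda>s. H (apply_bcontfun f s))) \<le> M * (c t - 0)"
      using c_in[of t] by (intro integral_bound Hf_cont H_bound) auto
    also have "\<dots> \<le> M * h" using c_in[of t] M0 by (intro mult_left_mono) auto
    finally show ?thesis .
  qed
  have \<Phi>_apply: "apply_bcontfun (\<Phi> f) t = y0 + integral {0..c t} (\<lambda>s. H (apply_bcontfun f s))"
    for f t
  proof -
    have 1: "continuous_on {0..h} (\<lambda>t. integral {0..t} (\<lambda>s. H (apply_bcontfun f s)))"
      by (intro indefinite_integral_continuous_1 integrable_continuous_real Hf_cont)
    have "continuous_on UNIV (\<lambda>t. integral {0..c t} (\<lambda>s. H (apply_bcontfun f s)))"
      by (rule continuous_on_compose2[OF 1])
         (use c_in in \<open>auto simp: c_def intro!: continuous_intros\<close>)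
    moreover have "bounded (range (\<lambda>t. y0 + integral {0..c t} (\<lambda>s. H (apply_bcontfun f s))))"
      unfolding bounded_iff
      by (rule exI[of _ "norm y0 + M * h"]) (auto intro: norm_triangle_le add_left_mono bound)
    ultimately show ?thesis
      unfolding \<Phi>_def
      by (subst Bcontfun_inverse) (auto simp: bcontfun_def intro!: continuous_intros)
  qed
  have "dist (\<Phi> f) (\<Phi> f') \<le> 1 / 2 * dist f f'" for f f'
  proof (rule dist_bound)
    fix t
    have "norm (integral {0..c t} (\<lambda>s. H (apply_bcontfun f s) - H (apply_bcontfun f' s)))
        \<le> (L * dist f f') * (c t - 0)"
    proof (rule integral_bound)
      fix s
      have "dist (H (apply_bcontfun f s)) (H (apply_bcontfun f' s))
          \<le> L * dist (apply_bcontfun f s) (apply_bcontfun f' s)" by (rule H_lip)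
      also have "\<dots> \<le> L * dist f f'" using dist_bounded L0 by (rule mult_left_mono)
      finally show "norm (H (apply_bcontfun f s) - H (apply_bcontfun f' s)) \<le> L * dist f f'"
        by (simp add: dist_norm)
    qed (use c_in[of t] in \<open>auto intro!: continuous_intros Hf_cont\<close>)
    also have "\<dots> \<le> (L * dist f f') * h"
      using c_in[of t] L0 by (intro mult_left_mono) auto
    also have "\<dots> \<le> 1 / 2 * dist f f'"
      using mult_right_mono[OF hL, of "dist f f'"] by (simp add: mult_ac)
    finally show "dist (apply_bcontfun (\<Phi> f) t) (apply_bcontfun (\<Phi> f') t) \<le> 1 / 2 * dist f f'"
      unfolding \<Phi>_apply dist_norm
      by (subst (asm) integral_diff) (auto intro!: integrable_continuous_real Hf_cont)
  qed
  then obtain f where f: "\<Phi> f = f"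
    using banach_fix_type[of "1/2" \<Phi>] by auto
  define y where "y = apply_bcontfun f"
  have y_eq: "y t = y0 + integral {0..c t} (\<lambda>s. H (y s))" for t
    using \<Phi>_apply[of f t] unfolding f y_def .
  have y_in: "y t \<in> cball y0 r" for t
  proof -
    have "norm (y t - y0) \<le> r"
      using order_trans[OF bound[of t f] hM] unfolding y_eq[of t] unfolding y_def by simp
    then show ?thesis by (simp add: dist_norm norm_minus_commute)
  qed
  show thesis
  proof (rule that[OF h0, of y])
    fix t assume t: "t \<in> {0<..<h}"
    have "((\<lambda>u. integral {0..u} (\<lambda>s. H (y s))) has_vector_derivative H (y t)) (at t within {0..h})"
      using t by (intro integral_has_vector_derivative) (auto simp: y_def intro!: Hf_cont)
    then have "((\<lambda>u. integral {0..u} (\<lambda>s. H (y s))) has_vector_derivative H (y t)) (at t)"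
      using t by (subst (asm) at_within_interior) auto
    then have "((\<lambda>u. y0 + integral {0..u} (\<lambda>s. H (y s))) has_vector_derivative H (y t)) (at t)"
      by (auto intro!: derivative_eq_intros)
    then have "(y has_vector_derivative H (y t)) (at t)"
    proof (rule has_vector_derivative_transform_within_open[where S = "{0<..<h}"])
      show "y0 + integral {0..x} (\<lambda>s. H (y s)) = y x" if "x \<in> {0<..<h}" for x
        using that unfolding y_eq[of x] by (simp add: c_def)
    qed (use t in auto)
    then show "(y has_vector_derivative F (y t)) (at t)"
      unfolding H_def o_def P_id[OF y_in] .
    show "y t \<in> cball y0 r" by (rule y_in)
  qed
qed

text \<open>Once positive, a solution stays positive to the right, since it is nondecreasing, and
  there 1/f + t is conserved. This is incompatible with survival up to the blow-up time.\<close>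

lemma riccati_not_global:
  fixes f :: "real \<Rightarrow> real"
  assumes deriv: "\<And>t. (f has_real_derivative (f t)\<^sup>2) (at t)"
  shows "f a = 0"
proof -
  have pos: False if f: "\<And>t. (f has_real_derivative (f t)\<^sup>2) (at t)" and a: "f a > 0"
    for f :: "real \<Rightarrow> real" and a
  proof -
    have mono: "f x \<le> f y" if "x \<le> y" for x y
    proof (rule DERIV_nonneg_imp_nondecreasing[OF that])
      fix z
      show "\<exists>d. (f has_real_derivative d) (at z) \<and> 0 \<le> d"
        by (rule exI[of _ "(f z)\<^sup>2"]) (simp add: f)
    qed
    have pos: "f t > 0" if "a \<le> t" for t using mono[OF that] a by simp
    \<comment> \<open>The blow-up time of the explicit solution: the conserved quantity
      \<open>k\<close> has the value \<open>b\<close> at \<open>a\<close>, so \<open>k b = b\<close>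
      would force \<open>1 / f b = 0\<close>.\<close>
    define b where "b = a + 1 / f a"
    have ab: "a < b" using a by (simp add: b_def)
    define k where "k t = 1 / f t + t" for t
    have k_deriv: "(k has_real_derivative 0) (at t)" if "a \<le> t" for t
    proof -
      have nz: "f t \<noteq> 0" using pos[OF that] by simp
      have "((\<lambda>t. 1 / f t + t) has_real_derivative
          (0 * f t - 1 * (f t)\<^sup>2) / (f t * f t) + 1) (at t)"
        by (intro DERIV_add DERIV_divide DERIV_const f DERIV_ident nz)
      moreover have "(0 * f t - 1 * (f t)\<^sup>2) / (f t * f t) + 1 = 0"
        using nz by (simp add: power2_eq_square)
      ultimately show ?thesis unfolding k_def[abs_def] by simp
    qed
    have "k b = k a"
    proof (rule DERIV_isconst_end[OF ab])
      show "continuous_on {a..b} k"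
        by (rule DERIV_continuous_on[of _ _ "\<lambda>_. 0"])
           (auto intro: has_field_derivative_at_within k_deriv)
    qed (auto intro: k_deriv)
    then have "1 / f b = 0" by (simp add: b_def k_def)
    then show False using pos[of b] ab by simp
  qed
  show ?thesis
  proof (rule ccontr)
    assume "f a \<noteq> 0"
    then consider "f a > 0" | "f a < 0" by linarith
    then show False
    proof cases
      case 1
      then show ?thesis using pos[of f a] deriv by blast
    next
      case 2
      \<comment> \<open>Reflecting both time and value preserves the equation and turns a negative
        value into a positive one.\<close>
      have "((\<lambda>t. - f (- t)) has_real_derivative (- f (- t))\<^sup>2) (at t)" for t
        by (rule derivative_eq_intros DERIV_chain2[OF deriv] refl | simp)+
      then show ?thesis using pos[of "\<lambda>t. - f (- t)" "- a"] 2 by auto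
    qed
  qed
qed

section \<open>Local Lipschitz continuity\<close>

text \<open>Hiding radius and constant gives a property stable under sums, products and linear maps,
  so that the spray can be assembled from its components. Closed balls match the hypothesis of
  \<open>picard_local_existence\<close>.\<close>

definition lipschitz_near :: "('a::metric_space \<Rightarrow> 'b::metric_space) \<Rightarrow> 'a \<Rightarrow> bool" where
  "lipschitz_near f x \<longleftrightarrow> (\<exists>r>0. \<exists>L. L-lipschitz_on (cball x r) f)"

lemma lipschitz_near_const: "lipschitz_near (\<lambda>x. c) x"
  unfolding lipschitz_near_def using lipschitz_on_constant zero_less_one by blast

lemma lipschitz_near_ident: "lipschitz_near (\<lambda>y. y) x"
  unfolding lipschitz_near_def using lipschitz_on_id zero_less_one by blast

lemma lipschitz_near_add:
  fixes f g :: "'a::metric_space \<Rightarrow> 'b::real_normed_vector"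
  assumes "lipschitz_near f x" "lipschitz_near g x"
  shows "lipschitz_near (\<lambda>y. f y + g y) x"
proof -
  from assms obtain r s K L where rs: "r > 0" "s > 0"
    and f: "K-lipschitz_on (cball x r) f" and g: "L-lipschitz_on (cball x s) g"
    unfolding lipschitz_near_def by blast
  have "(K + L)-lipschitz_on (cball x (min r s)) (\<lambda>y. f y + g y)"
    using f g by (intro lipschitz_on_add) (auto elim!: lipschitz_on_subset)
  then show ?thesis unfolding lipschitz_near_def using rs by (metis min_less_iff_conj)
qed

lemma lipschitz_near_sum:
  fixes f :: "'i \<Rightarrow> 'a::metric_space \<Rightarrow> 'b::real_normed_vector"
  assumes "\<And>i. i \<in> I \<Longrightarrow> lipschitz_near (f i) x"
  shows "lipschitz_near (\<lambda>y. \<Sum>i\<in>I. f i y) x"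
  using assms
  by (induction I rule: infinite_finite_induct)
     (simp_all add: lipschitz_near_const lipschitz_near_add)

lemma lipschitz_near_bounded_linear:
  assumes "bounded_linear h" "lipschitz_near f x"
  shows "lipschitz_near (\<lambda>y. h (f y)) x"
proof -
  from assms(2) obtain r L where r: "r > 0" and f: "L-lipschitz_on (cball x r) f"
    unfolding lipschitz_near_def by blast
  obtain K where "K-lipschitz_on (f ` cball x r) h"
    using bounded_linear.lipschitz_boundE[OF assms(1)] by blast
  then have "(K * L)-lipschitz_on (cball x r) (\<lambda>y. h (f y))"
    using lipschitz_on_compose[OF f] by (simp add: o_def)
  then show ?thesis unfolding lipschitz_near_def using r by blast
qed

lemma lipschitz_near_compose_bounded_linear:
  assumes "bounded_linear h" "lipschitz_near f (h x)"
  shows "lipschitz_near (\<lambda>y. f (h y)) x"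
proof -
  from assms(2) obtain r L where r: "r > 0" and f: "L-lipschitz_on (cball (h x) r) f"
    unfolding lipschitz_near_def by blast
  obtain K where K: "K-lipschitz_on UNIV h"
    using bounded_linear.lipschitz_boundE[OF assms(1)] by blast
  have K0: "K \<ge> 0" using K by (rule lipschitz_on_nonneg)
  define s where "s = r / (K + 1)"
  have s: "s > 0" using r K0 by (simp add: s_def)
  have img: "h ` cball x s \<subseteq> cball (h x) r"
  proof clarsimp
    fix y assume y: "dist x y \<le> s"
    have "dist (h x) (h y) \<le> K * dist x y" using K by (auto dest: lipschitz_onD)
    also have "\<dots> \<le> (K + 1) * s" using y K0 by (intro mult_mono) auto
    also have "\<dots> = r" using K0 by (simp add: s_def)
    finally show "dist (h x) (h y) \<le> r" .
  qed
  have "(L * K)-lipschitz_on (cball x s) (\<lambda>y. f (h y))"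
    using lipschitz_on_compose[OF lipschitz_on_subset[OF K] lipschitz_on_subset[OF f img]]
    by (simp add: o_def)
  then show ?thesis unfolding lipschitz_near_def using s by blast
qed

lemma lipschitz_near_mult:
  fixes f g :: "'a::metric_space \<Rightarrow> real"
  assumes "lipschitz_near f x" "lipschitz_near g x"
  shows "lipschitz_near (\<lambda>y. f y * g y) x"
proof -
  from assms obtain r s K L where rs: "r > 0" "s > 0"
    and f: "K-lipschitz_on (cball x r) f" and g: "L-lipschitz_on (cball x s) g"
    unfolding lipschitz_near_def by blast
  define t where "t = min r s"
  have t: "t > 0" "t \<le> r" "t \<le> s" using rs by (auto simp: t_def)
  have K0: "K \<ge> 0" and L0: "L \<ge> 0" using f g lipschitz_on_nonneg by blast+
  \<comment> \<open>A product is Lipschitz only where the factors are bounded; \<open>B\<close> and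
    \<open>C\<close> bound them on the common ball.\<close>
  define B where "B = \<bar>f x\<bar> + K * t"
  define C where "C = \<bar>g x\<bar> + L * t"
  have fB: "\<bar>f y\<bar> \<le> B" if "y \<in> cball x t" for y
  proof -
    have "dist (f y) (f x) \<le> K * dist y x"
      using that t by (intro lipschitz_onD[OF f]) auto
    also have "\<dots> \<le> K * t" using that K0 by (intro mult_left_mono) (auto simp: dist_commute)
    finally show ?thesis unfolding B_def dist_real_def by linarith
  qed
  have gC: "\<bar>g y\<bar> \<le> C" if "y \<in> cball x t" for y
  proof -
    have "dist (g y) (g x) \<le> L * dist y x"
      using that t by (intro lipschitz_onD[OF g]) auto
    also have "\<dots> \<le> L * t" using that L0 by (intro mult_left_mono) (auto simp: dist_commute)
    finally show ?thesis unfolding C_def dist_real_def by linarith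
  qed
  have BC: "B \<ge> 0" "C \<ge> 0" using K0 L0 t by (auto simp: B_def C_def)
  have "(B * L + C * K)-lipschitz_on (cball x t) (\<lambda>y. f y * g y)"
  proof (rule lipschitz_onI)
    fix y z assume yz: "y \<in> cball x t" "z \<in> cball x t"
    have "dist (f y * g y) (f z * g z) = \<bar>f y * (g y - g z) + g z * (f y - f z)\<bar>"
      by (simp add: dist_real_def algebra_simps)
    also have "\<dots> \<le> \<bar>f y\<bar> * \<bar>g y - g z\<bar> + \<bar>g z\<bar> * \<bar>f y - f z\<bar>"
      by (metis abs_mult abs_triangle_ineq)
    also have "\<dots> \<le> B * (L * dist y z) + C * (K * dist y z)"
      using lipschitz_onD[OF f, of y z] lipschitz_onD[OF g, of y z] yz t BC fB gC
      by (intro add_mono mult_mono) (auto simp: dist_real_def)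
    finally show "dist (f y * g y) (f z * g z) \<le> (B * L + C * K) * dist y z"
      by (simp add: algebra_simps)
  qed (use BC K0 L0 in auto)
  then show ?thesis unfolding lipschitz_near_def using t by blast
qed

lemma lipschitz_near_Pair:
  assumes "lipschitz_near f x" "lipschitz_near g x"
  shows "lipschitz_near (\<lambda>y. (f y, g y)) x"
proof -
  from assms obtain r s K L where rs: "r > 0" "s > 0"
    and f: "K-lipschitz_on (cball x r) f" and g: "L-lipschitz_on (cball x s) g"
    unfolding lipschitz_near_def by blast
  have "(sqrt (K\<^sup>2 + L\<^sup>2))-lipschitz_on (cball x (min r s)) (\<lambda>y. (f y, g y))"
    using f g by (intro lipschitz_on_Pair) (auto elim!: lipschitz_on_subset)
  then show ?thesis unfolding lipschitz_near_def using rs by (metis min_less_iff_conj)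
qed

lemma lipschitz_near_subset:
  assumes "lipschitz_near f x" "open V" "x \<in> V"
  obtains r L where "r > 0" "cball x r \<subseteq> V" "L-lipschitz_on (cball x r) f"
proof -
  from assms(1) obtain r L where r: "r > 0" and f: "L-lipschitz_on (cball x r) f"
    unfolding lipschitz_near_def by blast
  obtain s where s: "s > 0" "cball x s \<subseteq> V" using assms open_contains_cball by blast
  show thesis
  proof (rule that[of "min r s"])
    show "L-lipschitz_on (cball x (min r s)) f" using f by (rule lipschitz_on_subset) auto
    show "cball x (min r s) \<subseteq> V" using s(2) by auto
  qed (use r s in auto)
qed

section \<open>Smooth functions are locally Lipschitz\<close>

lemma linear_basis_expansion:
  fixes f :: "'e::euclidean_space \<Rightarrow> 'f::real_vector"
  assumes "linear f"
  shows "f u = (\<Sum>i\<in>Basis. (u \<bullet> i) *\<^sub>R f i)"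
proof -
  have "f u = f (\<Sum>i\<in>Basis. (u \<bullet> i) *\<^sub>R i)" by (simp add: euclidean_representation)
  then show ?thesis by (simp add: linear_sum[OF assms] linear_cmul[OF assms])
qed

lemma smooth_on_differentiable: "smooth_on U f \<Longrightarrow> x \<in> U \<Longrightarrow> f differentiable (at x)"
  unfolding smooth_on_def by (metis iterated_deriv.simps(1))

text \<open>The head of the list is the derivative taken last, so differentiating along
  \<open>v\<close> first amounts to appending \<open>v\<close> at the end.\<close>

lemma smooth_on_frechet:
  assumes "smooth_on U f"
  shows "smooth_on U (\<lambda>x. frechet_derivative f (at x) v)"
proof -
  have "iterated_deriv (\<lambda>x. frechet_derivative f (at x) v) vs = iterated_deriv f (vs @ [v])" for vs
    by (induction vs) auto
  then show ?thesis using assms unfolding smooth_on_def by auto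
qed

text \<open>Differentiability of the first directional derivatives makes them continuous. The sum of
  their norms over the basis dominates the operator norm, hence this norm is bounded on a small
  ball, and the mean value inequality applies because balls are convex.\<close>

lemma smooth_on_lipschitz_near:
  fixes f :: "'e::euclidean_space \<Rightarrow> 'f::real_normed_vector"
  assumes f: "smooth_on U f" and U: "open U" "x \<in> U"
  shows "lipschitz_near f x"
proof -
  define D where "D y v = frechet_derivative f (at y) v" for y v
  have deriv: "(f has_derivative D y) (at y)" if "y \<in> U" for y
    using smooth_on_differentiable[OF f that] frechet_derivative_works
    unfolding D_def[abs_def] by blast
  have "isCont (\<lambda>y. D y i) x" for i
    unfolding D_def
    by (rule differentiable_imp_continuous_within)
       (rule smooth_on_differentiable[OF smooth_on_frechet[OF f] U(2)])
  then have "isCont (\<lambda>y. \<Sum>i\<in>Basis. norm (D y i)) x" by (intro continuous_intros)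
  then have "((\<lambda>y. \<Sum>i\<in>Basis. norm (D y i)) \<longlongrightarrow> (\<Sum>i\<in>Basis. norm (D x i))) (nhds x)"
    unfolding continuous_at by (rule tendsto_at_iff_tendsto_nhds[THEN iffD1])
  then have "\<forall>\<^sub>F y in nhds x. (\<Sum>i\<in>Basis. norm (D y i)) < (\<Sum>i\<in>Basis. norm (D x i)) + 1"
    by (rule order_tendstoD(2)) simp
  moreover have "\<forall>\<^sub>F y in nhds x. y \<in> U" using U by (rule eventually_nhds_in_open)
  ultimately have "\<forall>\<^sub>F y in nhds x. y \<in> U \<and> (\<Sum>i\<in>Basis. norm (D y i)) < (\<Sum>i\<in>Basis. norm (D x i)) + 1"
    by eventually_elim simp
  then obtain r where r: "r > 0" "\<And>y. dist y x < r \<Longrightarrow>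
      y \<in> U \<and> (\<Sum>i\<in>Basis. norm (D y i)) < (\<Sum>i\<in>Basis. norm (D x i)) + 1"
    unfolding eventually_nhds_metric by blast
  define L where "L = (\<Sum>i\<in>Basis. norm (D x i)) + 1"
  have L0: "L \<ge> 0" unfolding L_def by (simp add: sum_nonneg)
  have near: "y \<in> U" "(\<Sum>i\<in>Basis. norm (D y i)) \<le> L" if "y \<in> cball x (r / 2)" for y
    using r(2)[of y] that r(1) by (auto simp: L_def dist_commute)
  have "L-lipschitz_on (cball x (r / 2)) f"
  proof (rule lipschitz_onI)
    fix y z assume yz: "y \<in> cball x (r / 2)" "z \<in> cball x (r / 2)"
    have "norm (f y - f z) \<le> L * norm (y - z)"
    proof (rule differentiable_bound[where S = "cball x (r / 2)" and f' = D])
      fix w assume w: "w \<in> cball x (r / 2)"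
      show dw: "(f has_derivative D w) (at w within cball x (r / 2))"
        using deriv[OF near(1)[OF w]] by (rule has_derivative_at_withinI)
      have lin: "linear (D w)" using dw by (rule has_derivative_linear)
      show "onorm (D w) \<le> L"
      proof (rule onorm_le)
        fix h
        have "D w h = (\<Sum>i\<in>Basis. (h \<bullet> i) *\<^sub>R D w i)"
          by (rule linear_basis_expansion[OF lin])
        also have "norm \<dots> \<le> (\<Sum>i\<in>Basis. norm (D w i) * norm h)"
        proof (intro sum_norm_le)
          fix i :: 'e assume "i \<in> Basis"
          then have "\<bar>h \<bullet> i\<bar> \<le> norm h" by (rule Basis_le_norm)
          then show "norm ((h \<bullet> i) *\<^sub>R D w i) \<le> norm (D w i) * norm h"
            by (simp add: mult.commute mult_right_mono)
        qed
        also have "\<dots> \<le> L * norm h"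
          unfolding sum_distrib_right[symmetric] using near(2)[OF w] by (rule mult_right_mono) simp
        finally show "norm (D w h) \<le> L * norm h" .
      qed
    qed (use yz in auto)
    then show "dist (f y) (f z) \<le> L * dist y z" by (simp add: dist_norm)
  qed (rule L0)
  then show ?thesis unfolding lipschitz_near_def using r(1) by (intro exI[of _ "r/2"]) auto
qed

lemma lipschitz_near_common:
  assumes "finite I" "\<And>i. i \<in> I \<Longrightarrow> lipschitz_near (f i) x"
  shows "\<exists>r>0. \<exists>L. \<forall>i\<in>I. L-lipschitz_on (cball x r) (f i)"
  using assms
proof (induction I rule: finite_induct)
  case empty
  then show ?case using zero_less_one by blast
next
  case (insert i I)
  obtain r L where rL: "r > 0" "\<forall>j\<in>I. L-lipschitz_on (cball x r) (f j)"
    using insert by blast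
  obtain s K where sK: "s > 0" "K-lipschitz_on (cball x s) (f i)"
    using insert.prems unfolding lipschitz_near_def by blast
  have "(max K L)-lipschitz_on (cball x (min r s)) (f j)" if "j \<in> insert i I" for j
    using that rL(2) sK(2) by (auto elim!: lipschitz_on_mono)
  then show ?case using rL(1) sK(1) by (metis min_less_iff_conj)
qed

text \<open>Bounding the inverse of the form directly from below avoids differentiating an inverse
  matrix.\<close>

lemma lipschitz_near_representing_vector:
  fixes H :: "'y::metric_space \<Rightarrow> 'e::euclidean_space \<Rightarrow> 'e \<Rightarrow> real"
    and k :: "'y \<Rightarrow> 'e \<Rightarrow> real" and z :: "'y \<Rightarrow> 'e"
  assumes V: "open V" "y0 \<in> V"
    and bil: "\<And>y. y \<in> V \<Longrightarrow> bilinear (H y)"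
    and nondeg: "\<And>u. (\<And>v. H y0 u v = 0) \<Longrightarrow> u = 0"
    and Hlip: "\<And>i j. i \<in> Basis \<Longrightarrow> j \<in> Basis \<Longrightarrow> lipschitz_near (\<lambda>y. H y i j) y0"
    and klip: "\<And>j. j \<in> Basis \<Longrightarrow> lipschitz_near (\<lambda>y. k y j) y0"
    and z: "\<And>y j. y \<in> V \<Longrightarrow> j \<in> Basis \<Longrightarrow> H y (z y) j = k y j"
  shows "lipschitz_near z y0"
proof -
  \<comment> \<open>\<open>T y\<close> is the form \<open>H y\<close> turned into an endomorphism by
    the Euclidean inner product; \<open>z y\<close> then solves the linear equation
    \<open>T y (z y) = \<kappa> y\<close>.\<close>
  define T where "T y u = (\<Sum>j\<in>Basis. H y u j *\<^sub>R j)" for y u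
  define \<kappa> where "\<kappa> y = (\<Sum>j\<in>Basis. k y j *\<^sub>R j)" for y
  have Tz: "T y (z y) = \<kappa> y" if "y \<in> V" for y
    unfolding T_def \<kappa>_def using z[OF that] by (intro sum.cong) auto
  have lin: "linear (T y)" if "y \<in> V" for y
    using bil[OF that] unfolding T_def
    by (intro linearI)
       (simp_all add: bilinear_ladd bilinear_lmul scaleR_add_left sum.distrib scaleR_sum_right)
  have comp: "T y u \<bullet> j = H y u j" if "j \<in> Basis" for y u j
    unfolding T_def using that by (simp add: inner_sum_left_Basis)
  have "inj (T y0)"
    unfolding linear_injective_0[OF lin[OF V(2)]]
  proof (intro allI impI nondeg)
    fix u v assume "T y0 u = 0"
    then have 0: "H y0 u j = 0" if "j \<in> Basis" for j using comp[OF that, of y0 u] by simp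
    have "linear (H y0 u)" using bil[OF V(2)] by (simp add: bilinear_def)
    then show "H y0 u v = 0" by (rule linear_eq_0_on_span[of _ Basis]) (auto simp: 0)
  qed
  then obtain c where c: "c > 0" "\<And>u. c * norm u \<le> norm (T y0 u)"
    using linear_inj_bounded_below_pos[OF lin[OF V(2)]] by metis
  have \<kappa>lip: "lipschitz_near \<kappa> y0"
    unfolding \<kappa>_def
    by (intro lipschitz_near_sum lipschitz_near_bounded_linear[OF bounded_linear_scaleR_left] klip)
  obtain r0 K where r0: "r0 > 0" "cball y0 r0 \<subseteq> V" and K: "K-lipschitz_on (cball y0 r0) \<kappa>"
    using lipschitz_near_subset[OF \<kappa>lip V] .
  have K0: "K \<ge> 0" using K by (rule lipschitz_on_nonneg)
  have "\<exists>r>0. \<exists>L. \<forall>p\<in>Basis\<times>Basis. L-lipschitz_on (cball y0 r) (\<lambda>y. H y (fst p) (snd p))"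
    by (rule lipschitz_near_common) (auto intro: Hlip)
  then obtain r1 L where r1: "r1 > 0"
    and L: "\<And>i j. i \<in> Basis \<Longrightarrow> j \<in> Basis \<Longrightarrow> L-lipschitz_on (cball y0 r1) (\<lambda>y. H y i j)"
    by fastforce
  define M where "M = real DIM('e) * (real DIM('e) * \<bar>L\<bar>)"
  have M0: "M \<ge> 0" by (simp add: M_def)
  \<comment> \<open>On this ball \<open>T y\<close> differs from \<open>T y0\<close> by at most c/2
    in operator norm, so half of the lower bound \<open>c\<close> survives uniformly.\<close>
  define r where "r = min (min r0 r1) (c / (2 * (M + 1)))"
  have r: "r > 0" using r0 r1 c(1) M0 by (auto simp: r_def)
  have r_le: "cball y0 r \<subseteq> cball y0 r0" "cball y0 r \<subseteq> cball y0 r1" by (auto simp: r_def)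
  have "M * r \<le> M * (c / (2 * (M + 1)))" using M0 by (intro mult_left_mono) (auto simp: r_def)
  also have "\<dots> \<le> c / 2" using M0 c(1) by (simp add: field_simps)
  finally have Mr: "M * r \<le> c / 2" .
  have TM: "norm (T y u - T y' u) \<le> M * dist y y' * norm u"
    if y: "y \<in> cball y0 r" "y' \<in> cball y0 r" for y y' u
  proof -
    have yV: "y \<in> V" "y' \<in> V" using y r_le(1) r0(2) by blast+
    have "norm (T y i - T y' i) \<le> real DIM('e) * (\<bar>L\<bar> * dist y y')" if i: "i \<in> Basis" for i
    proof -
      have "norm (T y i - T y' i) = norm (\<Sum>j\<in>Basis. (H y i j - H y' i j) *\<^sub>R j)"
        unfolding T_def by (simp add: sum_subtractf scaleR_diff_left)
      also have "\<dots> \<le> (\<Sum>j\<in>(Basis::'e set). \<bar>L\<bar> * dist y y')"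
      proof (intro sum_norm_le)
        fix j :: 'e assume j: "j \<in> Basis"
        have "\<bar>H y i j - H y' i j\<bar> \<le> L * dist y y'"
          using lipschitz_onD[OF L[OF i j]] y r_le(2) unfolding dist_real_def by blast
        also have "\<dots> \<le> \<bar>L\<bar> * dist y y'" by (intro mult_right_mono) auto
        finally show "norm ((H y i j - H y' i j) *\<^sub>R j) \<le> \<bar>L\<bar> * dist y y'" using j by simp
      qed
      finally show ?thesis by simp
    qed
    note Ti = this
    have "T y u - T y' u = (\<Sum>i\<in>Basis. (u \<bullet> i) *\<^sub>R (T y i - T y' i))"
      by (simp add: linear_basis_expansion[OF lin[OF yV(1)], of u]
          linear_basis_expansion[OF lin[OF yV(2)], of u] scaleR_diff_right sum_subtractf)
    also have "norm \<dots> \<le> (\<Sum>i\<in>(Basis::'e set). norm u * (real DIM('e) * (\<bar>L\<bar> * dist y y')))"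
      by (intro sum_norm_le) (auto intro!: mult_mono Ti Basis_le_norm)
    also have "\<dots> = M * dist y y' * norm u" by (simp add: M_def mult_ac)
    finally show ?thesis .
  qed
  have below: "c / 2 * norm u \<le> norm (T y u)" if y: "y \<in> cball y0 r" for y u
  proof -
    have "norm (T y0 u - T y u) \<le> M * dist y0 y * norm u"
      using r y by (intro TM) auto
    also have "\<dots> \<le> M * r * norm u"
      using y M0 by (intro mult_right_mono mult_left_mono) auto
    also have "\<dots> \<le> c / 2 * norm u" using Mr by (intro mult_right_mono) auto
    finally have "norm (T y0 u - T y u) \<le> c / 2 * norm u" .
    then show ?thesis using c(2)[of u] norm_triangle_sub[of "T y0 u" "T y u"] by linarith
  qed
  define B where "B = 2 / c * (norm (\<kappa> y0) + K * r)"
  have zB: "norm (z y) \<le> B" if y: "y \<in> cball y0 r" for y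
  proof -
    have "dist (\<kappa> y) (\<kappa> y0) \<le> K * dist y y0"
      using y r0(1) r_le(1) by (intro lipschitz_onD[OF K]) auto
    also have "\<dots> \<le> K * r" using y K0 by (intro mult_left_mono) (auto simp: dist_commute)
    finally have "norm (\<kappa> y) \<le> norm (\<kappa> y0) + K * r"
      using norm_triangle_sub[of "\<kappa> y" "\<kappa> y0"] unfolding dist_norm by linarith
    moreover have "T y (z y) = \<kappa> y" using Tz y r_le(1) r0(2) by blast
    ultimately have "c / 2 * norm (z y) \<le> norm (\<kappa> y0) + K * r" using below[OF y, of "z y"] by simp
    then show ?thesis using c(1) by (simp add: B_def field_simps)
  qed
  have B0: "B \<ge> 0" using c(1) K0 r by (simp add: B_def)
  have "(2 / c * (K + M * B))-lipschitz_on (cball y0 r) z"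
  proof (rule lipschitz_onI)
    fix y y' assume y: "y \<in> cball y0 r" "y' \<in> cball y0 r"
    have yV: "y \<in> V" "y' \<in> V" using y r_le(1) r0(2) by blast+
    \<comment> \<open>Subtracting the equations at \<open>y\<close> and \<open>y'\<close> leaves
      only differences of the data on the right; the lower bound for \<open>T y\<close> converts
      this into a bound for the difference of solutions.\<close>
    have "T y (z y - z y') = (\<kappa> y - \<kappa> y') - (T y (z y') - T y' (z y'))"
      by (simp add: linear_diff[OF lin[OF yV(1)]] Tz yV)
    then have "c / 2 * norm (z y - z y') \<le> norm ((\<kappa> y - \<kappa> y') - (T y (z y') - T y' (z y')))"
      using below[OF y(1), of "z y - z y'"] by simp
    also have "\<dots> \<le> norm (\<kappa> y - \<kappa> y') + norm (T y (z y') - T y' (z y'))"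
      by (rule norm_triangle_ineq4)
    also have "\<dots> \<le> K * dist y y' + M * dist y y' * B"
    proof (rule add_mono)
      show "norm (\<kappa> y - \<kappa> y') \<le> K * dist y y'"
        using lipschitz_onD[OF K] y r_le(1) unfolding dist_norm by blast
      show "norm (T y (z y') - T y' (z y')) \<le> M * dist y y' * B"
        using TM[OF y, of "z y'"] mult_left_mono[OF zB[OF y(2)], of "M * dist y y'"] M0 by simp
    qed
    finally show "dist (z y) (z y') \<le> 2 / c * (K + M * B) * dist y y'"
      using c(1) by (simp add: dist_norm field_simps)
  qed (use c(1) K0 M0 B0 in auto)
  then show ?thesis unfolding lipschitz_near_def using r by blast
qed

section \<open>Metrics on open subsets of a Euclidean space\<close>

lemma bilinear_basis_expansion:
  fixes B :: "'d::euclidean_space \<Rightarrow> 'e::euclidean_space \<Rightarrow> 'f::real_vector"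
  assumes "bilinear B"
  shows "B u v = (\<Sum>i\<in>Basis. \<Sum>j\<in>Basis. ((u \<bullet> i) * (v \<bullet> j)) *\<^sub>R B i j)"
proof -
  have 1: "linear (\<lambda>u. B u v)" and 2: "linear (B i)" for i
    using assms by (simp_all add: bilinear_def)
  have "B u v = (\<Sum>i\<in>Basis. (u \<bullet> i) *\<^sub>R B i v)" by (rule linear_basis_expansion[OF 1])
  also have "\<dots> = (\<Sum>i\<in>Basis. (u \<bullet> i) *\<^sub>R (\<Sum>j\<in>Basis. (v \<bullet> j) *\<^sub>R B i j))"
    by (subst linear_basis_expansion[OF 2]) (rule refl)
  finally show ?thesis by (simp add: scaleR_sum_right)
qed

text \<open>The metric read in the coordinates of one chart. The calculus takes place on an open
  subset of the model space; \<open>chart_inv\<close> carries the results back to the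
  manifold.\<close>

locale local_metric =
  fixes U :: "'e::euclidean_space set" and G :: "'e \<Rightarrow> 'e \<Rightarrow> 'e \<Rightarrow> real"
  assumes open_U: "open U"
    and bil: "x \<in> U \<Longrightarrow> bilinear (G x)"
    and smooth: "smooth_on U (\<lambda>x. G x u v)"
    and sym: "x \<in> U \<Longrightarrow> G x u v = G x v u"
    and nondeg: "x \<in> U \<Longrightarrow> (\<And>v. G x u v = 0) \<Longrightarrow> u = 0"
begin

definition dG :: "'e \<Rightarrow> 'e \<Rightarrow> 'e \<Rightarrow> 'e \<Rightarrow> real" where
  "dG x h u v = frechet_derivative (\<lambda>y. G y u v) (at x) h"

text \<open>The same description as in \<open>christoffel\<close>, so that the two agree in a chart
  by unfolding.\<close>

definition Gam :: "'e \<Rightarrow> 'e \<Rightarrow> 'e \<Rightarrow> 'e" where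
  "Gam x u v = (THE z. \<forall>w. 2 * G x z w = dG x u v w + dG x v u w - dG x w u v)"

lemma dG_deriv: "x \<in> U \<Longrightarrow> ((\<lambda>y. G y u v) has_derivative (\<lambda>h. dG x h u v)) (at x)"
  using smooth_on_differentiable[OF smooth] frechet_derivative_works unfolding dG_def by blast

lemma linear_dG: "x \<in> U \<Longrightarrow> linear (\<lambda>h. dG x h u v)"
  by (rule has_derivative_linear[OF dG_deriv])

text \<open>By uniqueness of the derivative, an identity for \<open>G\<close> on the open set
  \<open>U\<close> can be differentiated; \<open>dG\<close> inherits bilinearity and symmetry from
  \<open>G\<close> in this way.\<close>

lemma dG_eqI:
  assumes "x \<in> U" "\<And>y. y \<in> U \<Longrightarrow> G y u v = f y" "(f has_derivative f') (at x)"
  shows "dG x h u v = f' h"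
proof -
  have "((\<lambda>y. G y u v) has_derivative f') (at x)"
    using assms open_U by (intro has_derivative_transform_within_open[OF assms(3)]) auto
  from has_derivative_unique[OF dG_deriv[OF assms(1)] this] show ?thesis by meson
qed

lemma bilinear_dG:
  assumes x: "x \<in> U"
  shows "bilinear (dG x h)"
  unfolding bilinear_def
proof (intro conjI allI linearI)
  fix u v w :: 'e and c :: real
  note d = dG_deriv[OF x]
  show "dG x h u (v + w) = dG x h u v + dG x h u w"
    by (rule dG_eqI[OF x _ has_derivative_add[OF d d]]) (simp add: bilinear_radd[OF bil])
  show "dG x h (v + w) u = dG x h v u + dG x h w u"
    by (rule dG_eqI[OF x _ has_derivative_add[OF d d]]) (simp add: bilinear_ladd[OF bil])
  show "dG x h u (c *\<^sub>R v) = c *\<^sub>R dG x h u v"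
    by (rule dG_eqI[OF x _ has_derivative_scaleR_right[OF d]]) (simp add: bilinear_rmul[OF bil])
  show "dG x h (c *\<^sub>R v) u = c *\<^sub>R dG x h v u"
    by (rule dG_eqI[OF x _ has_derivative_scaleR_right[OF d]]) (simp add: bilinear_lmul[OF bil])
qed

text \<open>Smoothness of \<open>G\<close> is given for fixed vector arguments only, so the product
  rule goes through the expansion in a basis. The parameter space is left general: it is the time
  axis for the pairing along a geodesic, the chart image for the diagonal of S, and phase space for
  continuity of the pairing.\<close>

lemma G_deriv:
  fixes p a b :: "'y::real_normed_vector \<Rightarrow> 'e"
  assumes p: "(p has_derivative p') (at y0)" and a: "(a has_derivative a') (at y0)"
    and b: "(b has_derivative b') (at y0)" and p0: "p y0 \<in> U"
  shows "((\<lambda>y. G (p y) (a y) (b y)) has_derivative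
    (\<lambda>h. dG (p y0) (p' h) (a y0) (b y0) + G (p y0) (a' h) (b y0) + G (p y0) (a y0) (b' h))) (at y0)"
proof -
  have ev: "\<forall>\<^sub>F y in at y0. p y \<in> U"
    using has_derivative_continuous[OF p] open_U p0
    unfolding continuous_at by (rule topological_tendstoD)
  have G: "((\<lambda>y. G (p y) i j) has_derivative (\<lambda>h. dG (p y0) (p' h) i j)) (at y0)" for i j
    by (rule has_derivative_compose[OF p dG_deriv[OF p0]])
  have "((\<lambda>y. \<Sum>i\<in>Basis. \<Sum>j\<in>Basis. ((a y \<bullet> i) * (b y \<bullet> j)) * G (p y) i j) has_derivative
      (\<lambda>h. \<Sum>i\<in>Basis. \<Sum>j\<in>Basis.
        ((a y0 \<bullet> i) * (b y0 \<bullet> j)) * dG (p y0) (p' h) i j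
        + ((a y0 \<bullet> i) * (b' h \<bullet> j) + (a' h \<bullet> i) * (b y0 \<bullet> j)) * G (p y0) i j)) (at y0)"
    by (intro has_derivative_sum has_derivative_mult has_derivative_inner_left a b G)
  then have "((\<lambda>y. \<Sum>i\<in>Basis. \<Sum>j\<in>Basis. ((a y \<bullet> i) * (b y \<bullet> j)) * G (p y) i j) has_derivative
      (\<lambda>h. dG (p y0) (p' h) (a y0) (b y0) + G (p y0) (a' h) (b y0) + G (p y0) (a y0) (b' h))) (at y0)"
    unfolding bilinear_basis_expansion[OF bilinear_dG[OF p0], of _ "a y0" "b y0"]
      bilinear_basis_expansion[OF bil[OF p0], of "a' _" "b y0"]
      bilinear_basis_expansion[OF bil[OF p0], of "a y0" "b' _"]
    by (simp add: sum.distrib distrib_right add_ac)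
  then show ?thesis
    by (rule has_derivative_transform_eventually)
       (use ev p0 in \<open>auto elim!: eventually_mono
          simp: bilinear_basis_expansion[OF bil, of "p _" "a _" "b _"]\<close>)
qed

text \<open>Riesz representation for a possibly indefinite form: nondegeneracy makes the
  index-lowering map \<open>T\<close> injective, and in finite dimension it is then onto.\<close>

lemma ex_representing_vector:
  assumes x: "x \<in> U" and k: "linear k"
  shows "\<exists>z. \<forall>w. G x z w = k w"
proof -
  define T where "T u = (\<Sum>j\<in>Basis. G x u j *\<^sub>R j)" for u
  have linT: "linear T"
    using bil[OF x] unfolding T_def
    by (intro linearI)
       (simp_all add: bilinear_ladd bilinear_lmul scaleR_add_left sum.distrib scaleR_sum_right)
  have comp: "T u \<bullet> j = G x u j" if "j \<in> Basis" for u j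
    unfolding T_def using that by (simp add: inner_sum_left_Basis)
  have G_expand: "G x u w = (\<Sum>j\<in>Basis. (w \<bullet> j) *\<^sub>R G x u j)" for u w
    using bil[OF x] by (intro linear_basis_expansion) (simp add: bilinear_def)
  have "inj T"
    unfolding linear_injective_0[OF linT]
  proof (intro allI impI nondeg[OF x])
    fix u v assume "T u = 0"
    then have "G x u j = 0" if "j \<in> Basis" for j using comp[OF that, of u] by simp
    then show "G x u v = 0" by (simp add: G_expand[of u v])
  qed
  then have "surj T" using linear_injective_imp_surjective linT by blast
  then obtain z where "T z = (\<Sum>j\<in>Basis. k j *\<^sub>R j)" by (metis surjD)
  then have "G x z j = k j" if "j \<in> Basis" for j
    using comp[OF that, of z] that by (simp add: inner_sum_left_Basis)
  then have "G x z w = k w" for w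
    by (simp add: G_expand[of z w] linear_basis_expansion[OF k, of w])
  then show ?thesis by blast
qed

lemma metric_left_cancel:
  assumes x: "x \<in> U" and eq: "\<And>w. G x z w = G x z' w"
  shows "z = z'"
proof -
  have "G x (z - z') w = 0" for w by (simp add: bilinear_lsub[OF bil[OF x]] eq)
  then show ?thesis using nondeg[OF x, of "z - z'"] by simp
qed

lemma Gam_eq:
  assumes x: "x \<in> U"
  shows "2 * G x (Gam x u v) w = dG x u v w + dG x v u w - dG x w u v"
proof -
  define k where "k w = (dG x u v w + dG x v u w - dG x w u v) / 2" for w
  have "linear k"
    unfolding k_def
    by (intro linearI)
       (simp_all add: bilinear_radd[OF bilinear_dG[OF x]] bilinear_rmul[OF bilinear_dG[OF x]]
          linear_add[OF linear_dG[OF x]] linear_cmul[OF linear_dG[OF x]] field_simps)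
  from ex_representing_vector[OF x this] obtain z where z: "\<And>w. G x z w = k w" by blast
  have "\<forall>w. 2 * G x (Gam x u v) w = dG x u v w + dG x v u w - dG x w u v"
    unfolding Gam_def
  proof (rule theI[of _ z])
    show "\<forall>w. 2 * G x z w = dG x u v w + dG x v u w - dG x w u v"
      unfolding z k_def by simp
    fix z' assume "\<forall>w. 2 * G x z' w = dG x u v w + dG x v u w - dG x w u v"
    then have "G x z' w = G x z w" for w unfolding z k_def by (simp add: field_simps)
    then show "z' = z" by (rule metric_left_cancel[OF x])
  qed
  then show ?thesis by blast
qed

lemma linear_Gam:
  assumes x: "x \<in> U"
  shows "linear (Gam x u)"
proof (rule linearI)
  note simps = bilinear_ladd[OF bilinear_dG[OF x]] bilinear_lmul[OF bilinear_dG[OF x]]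
    bilinear_radd[OF bilinear_dG[OF x]] bilinear_rmul[OF bilinear_dG[OF x]]
    linear_add[OF linear_dG[OF x]] linear_cmul[OF linear_dG[OF x]]
    bilinear_ladd[OF bil[OF x]] bilinear_lmul[OF bil[OF x]]
  fix v v' and c :: real
  show "Gam x u (v + v') = Gam x u v + Gam x u v'"
  proof (rule metric_left_cancel[OF x])
    fix w
    have "2 * G x (Gam x u (v + v')) w = 2 * G x (Gam x u v) w + 2 * G x (Gam x u v') w"
      unfolding Gam_eq[OF x] by (simp add: simps)
    then show "G x (Gam x u (v + v')) w = G x (Gam x u v + Gam x u v') w"
      by (simp add: simps)
  qed
  show "Gam x u (c *\<^sub>R v) = c *\<^sub>R Gam x u v"
  proof (rule metric_left_cancel[OF x])
    fix w
    have "2 * G x (Gam x u (c *\<^sub>R v)) w = c * (2 * G x (Gam x u v) w)"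
      unfolding Gam_eq[OF x] by (simp add: simps algebra_simps)
    then show "G x (Gam x u (c *\<^sub>R v)) w = G x (c *\<^sub>R Gam x u v) w"
      by (simp add: simps)
  qed
qed

text \<open>This is the geodesic equation as a first-order system on phase space. The vector
  \<open>Gam\<close> is never differentiated: it is recovered from its pairings with a basis, which
  are polynomial in the velocity with coefficients smooth in the position.\<close>

lemma lipschitz_near_geodesic_spray:
  assumes x: "x \<in> U"
  shows "lipschitz_near (\<lambda>y. (snd y, - Gam (fst y) (snd y) (snd y))) (x, v)"
proof (intro lipschitz_near_Pair)
  let ?V = "U \<times> (UNIV :: 'e set)"
  have V: "open ?V" "(x, v) \<in> ?V" using open_U x by (auto intro: open_Times)
  have snd: "lipschitz_near (snd :: 'e \<times> 'e \<Rightarrow> 'e) (x, v)"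
    by (rule lipschitz_near_bounded_linear[OF bounded_linear_snd lipschitz_near_ident])
  then show "lipschitz_near (\<lambda>y. snd y :: 'e) (x, v)" by simp
  have lip: "lipschitz_near (\<lambda>y. f (fst y)) (x, v)" if "smooth_on U f" for f :: "'e \<Rightarrow> real"
    using smooth_on_lipschitz_near[OF that open_U x]
    by (intro lipschitz_near_compose_bounded_linear[OF bounded_linear_fst]) simp
  have dlip: "lipschitz_near (\<lambda>y. dG (fst y) h i j) (x, v)" for h i j
    unfolding dG_def by (intro lip smooth_on_frechet smooth)
  have vlip: "lipschitz_near (\<lambda>y. snd y \<bullet> i) (x, v)" for i
    by (rule lipschitz_near_bounded_linear[OF bounded_linear_inner_left snd])
  have "lipschitz_near (\<lambda>y. Gam (fst y) (snd y) (snd y)) (x, v)"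
  proof (rule lipschitz_near_representing_vector[OF V])
    show "bilinear (G (fst y))" if "y \<in> ?V" for y using bil that by auto
    show "u = 0" if "\<And>w. G (fst (x, v)) u w = 0" for u using nondeg[OF x] that by auto
    show "lipschitz_near (\<lambda>y. G (fst y) i j) (x, v)" for i j by (intro lip smooth)
    \<comment> \<open>Half of the Koszul right-hand side for equal arguments v, namely dG(v;v,j) -
      dG(j;v,v)/2, with v expanded so that only derivatives of fixed components occur.\<close>
    let ?k = "\<lambda>y j. (\<Sum>a\<in>Basis. \<Sum>b\<in>Basis. (snd y \<bullet> a) * (snd y \<bullet> b) * dG (fst y) a b j)
      + (- 1 / 2) * (\<Sum>a\<in>Basis. \<Sum>b\<in>Basis. (snd y \<bullet> a) * (snd y \<bullet> b) * dG (fst y) j a b)"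
    show "lipschitz_near (\<lambda>y. ?k y j) (x, v)" for j
      by (intro lipschitz_near_add lipschitz_near_sum lipschitz_near_mult vlip dlip
          lipschitz_near_const)
    fix y j assume "y \<in> ?V"
    then have y: "fst y \<in> U" by auto
    have 1: "bilinear (\<lambda>h u. dG (fst y) h u j)"
      using linear_dG[OF y] bilinear_dG[OF y] by (simp add: bilinear_def)
    have "2 * G (fst y) (Gam (fst y) (snd y) (snd y)) j =
        2 * dG (fst y) (snd y) (snd y) j - dG (fst y) j (snd y) (snd y)"
      unfolding Gam_eq[OF y] by simp
    moreover have "dG (fst y) (snd y) (snd y) j =
        (\<Sum>a\<in>Basis. \<Sum>b\<in>Basis. (snd y \<bullet> a) * (snd y \<bullet> b) * dG (fst y) a b j)"
      using bilinear_basis_expansion[OF 1, of "snd y" "snd y"] by simp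
    moreover have "dG (fst y) j (snd y) (snd y) =
        (\<Sum>a\<in>Basis. \<Sum>b\<in>Basis. (snd y \<bullet> a) * (snd y \<bullet> b) * dG (fst y) j a b)"
      using bilinear_basis_expansion[OF bilinear_dG[OF y], of j "snd y" "snd y"] by simp
    ultimately show "G (fst y) (Gam (fst y) (snd y) (snd y)) j = ?k y j" by linarith
  qed
  then show "lipschitz_near (\<lambda>y. - Gam (fst y) (snd y) (snd y)) (x, v)"
    by (rule lipschitz_near_bounded_linear[OF bounded_linear_minus[OF bounded_linear_ident]])
qed

section \<open>Covariant derivatives: the Riccati equation and parallel tensors\<close>

lemma dG_sym: "x \<in> U \<Longrightarrow> dG x h u v = dG x h v u"
  by (rule dG_eqI[OF _ _ dG_deriv]) (simp_all add: sym)

text \<open>The Levi-Civita connection is metric: adding the Koszul identities for (u,v,w) and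
  (u,w,v) cancels all but the derivative along \<open>u\<close>.\<close>

lemma Gam_metric:
  assumes x: "x \<in> U"
  shows "dG x u v w = G x (Gam x u v) w + G x v (Gam x u w)"
  using Gam_eq[OF x, of u v w] Gam_eq[OF x, of u w v] dG_sym[OF x, of u w v]
    dG_sym[OF x, of v u w] dG_sym[OF x, of w u v] sym[OF x, of v "Gam x u w"] dG_sym[OF x, of w v u]
  by argo

text \<open>By \<open>Gam_metric\<close> the derivative of the metric splits into two Christoffel
  terms. One completes \<open>X'\<close> to the covariant derivative of X, the other cancels the
  acceleration; what remains is G(v,X) G(X,v).\<close>

lemma pairing_deriv:
  assumes X: "(X has_derivative X') (at (x t))"
    and rec: "X' (v t) + Gam (x t) (v t) (X (x t)) = G (x t) (v t) (X (x t)) *\<^sub>R X (x t)"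
    and x: "(x has_vector_derivative v t) (at t)"
    and v: "(v has_vector_derivative - Gam (x t) (v t) (v t)) (at t)"
    and U: "x t \<in> U"
  shows "((\<lambda>s. G (x s) (X (x s)) (v s)) has_real_derivative (G (x t) (X (x t)) (v t))\<^sup>2) (at t)"
proof -
  let ?D = "\<lambda>h. dG (x t) (h *\<^sub>R v t) (X (x t)) (v t) + G (x t) (X' (h *\<^sub>R v t)) (v t)
    + G (x t) (X (x t)) (h *\<^sub>R - Gam (x t) (v t) (v t))"
  have X_x: "((\<lambda>s. X (x s)) has_derivative (\<lambda>h. X' (h *\<^sub>R v t))) (at t)"
    by (rule has_derivative_compose[OF x[unfolded has_vector_derivative_def] X])
  have D: "((\<lambda>s. G (x s) (X (x s)) (v s)) has_derivative ?D) (at t)"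
    by (rule G_deriv[OF x[unfolded has_vector_derivative_def] X_x
          v[unfolded has_vector_derivative_def] U])
  \<comment> \<open>The derivative comes as a linear map of a real variable, so its value at 1
    determines it.\<close>
  have "?D h = h *\<^sub>R ?D 1" for h
    using linear_cmul[OF has_derivative_linear[OF D], of h 1] by simp
  moreover have "?D 1 = (G (x t) (X (x t)) (v t))\<^sup>2"
  proof -
    have X'_eq: "X' (v t) = G (x t) (v t) (X (x t)) *\<^sub>R X (x t) - Gam (x t) (v t) (X (x t))"
      using rec by (simp add: eq_diff_eq)
    show ?thesis
      by (simp add: X'_eq Gam_metric[OF U] bilinear_lsub[OF bil[OF U]] bilinear_lmul[OF bil[OF U]]
          bilinear_rneg[OF bil[OF U]] power2_eq_square sym[OF U, of "v t"])
  qed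
  ultimately have "?D = (*) ((G (x t) (X (x t)) (v t))\<^sup>2)"
    by (simp only: fun_eq_iff real_scaleR_def mult.commute) simp
  then show ?thesis using D unfolding has_field_derivative_def by simp
qed

text \<open>Polarizing the identity in the direction \<eta> and inserting the orthogonal vector
  \<open>j \<eta>\<close> leaves g(\<eta>,\<eta>) j \<eta> = 0, so \<eta> is null. For null \<eta>
  the polarized identity reads 2 g(v,\<eta>) \<eta> = g(\<eta>,v) \<eta>, and nondegeneracy gives
  \<eta> = 0.\<close>

lemma quadratic_eq_imp_zero:
  assumes x: "x \<in> U"
    and eq: "\<And>v. G x v v *\<^sub>R \<eta> = G x \<eta> v *\<^sub>R v"
    and j: "\<And>v. G x (j v) v = 0" "\<And>v. j v = 0 \<Longrightarrow> v = 0"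
  shows "\<eta> = 0"
proof -
  note B = bil[OF x]
  have polar: "(2 * G x v \<eta>) *\<^sub>R \<eta> = G x \<eta> v *\<^sub>R \<eta> + G x \<eta> \<eta> *\<^sub>R v" for v
  proof -
    have "G x (v + \<eta>) (v + \<eta>) *\<^sub>R \<eta> = G x \<eta> (v + \<eta>) *\<^sub>R (v + \<eta>)" by (rule eq)
    then have "G x v v *\<^sub>R \<eta> + (2 * G x v \<eta>) *\<^sub>R \<eta> + G x \<eta> \<eta> *\<^sub>R \<eta> =
        G x \<eta> v *\<^sub>R v + (G x \<eta> v *\<^sub>R \<eta> + G x \<eta> \<eta> *\<^sub>R v) + G x \<eta> \<eta> *\<^sub>R \<eta>"
      by (simp add: bilinear_ladd[OF B] bilinear_radd[OF B] sym[OF x, of \<eta> v] algebra_simps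
          flip: scaleR_2)
    then show ?thesis using eq[of v] by simp
  qed
  have "G x \<eta> \<eta> *\<^sub>R j \<eta> = 0"
    using polar[of "j \<eta>"] j(1)[of \<eta>] sym[OF x, of \<eta> "j \<eta>"] by simp
  then have "G x \<eta> \<eta> = 0 \<or> \<eta> = 0" using j(2) by auto
  then show ?thesis
  proof
    assume "G x \<eta> \<eta> = 0"
    then have "G x v \<eta> = 0 \<or> \<eta> = 0" for v
      using polar[of v] sym[OF x, of \<eta> v] by (simp flip: scaleR_left_diff_distrib)
    then show ?thesis using nondeg[OF x, of \<eta>] sym[OF x] by metis
  qed
qed

text \<open>Parallelism is evaluated on the diagonal only, where S is expressed by the metric and X;
  thus no derivative of J arises. Once parallelism of the metric replaces the derivatives of
  \<open>G\<close>, all terms cancel except those containing \<eta>.\<close>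

lemma recurrent_of_parallel:
  fixes S :: "'e \<Rightarrow> 'e \<Rightarrow> 'e \<Rightarrow> 'e" and X :: "'e \<Rightarrow> 'e"
  defines "C \<equiv> \<lambda>x u v. Gam x u v - S x u v"
  assumes x: "x \<in> U"
    and X: "(X has_derivative X') (at x)"
    and S_bil: "bilinear (S x)"
    and S_diag: "\<And>y v. y \<in> U \<Longrightarrow> S y v v = G y v v *\<^sub>R X y - G y (X y) v *\<^sub>R v"
    and S_X: "\<And>u. S x u (X x) = G x u (X x) *\<^sub>R X x"
    and g_par: "\<And>u v w. dG x u v w - G x (C x u v) w - G x v (C x u w) = 0"
    and S_par: "\<And>u v w. frechet_derivative (\<lambda>y. S y v w) (at x) u + C x u (S x v w)
        - S x (C x u v) w - S x v (C x u w) = 0"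
    and j: "\<And>v. G x (j v) v = 0" "\<And>v. j v = 0 \<Longrightarrow> v = 0"
  shows "X' u + Gam x u (X x) = G x u (X x) *\<^sub>R X x"
proof -
  note B = bil[OF x]
  define c where "c = C x u"
  define \<eta> where "\<eta> = X' u + c (X x)"
  have "linear (S x u)" using S_bil by (simp add: bilinear_def)
  then have c: "linear c"
    unfolding c_def C_def by (intro linear_compose_sub linear_Gam[OF x])
  have "\<eta> = 0"
  proof (rule quadratic_eq_imp_zero[OF x _ j])
    fix v
    have "((\<lambda>y. G y v v *\<^sub>R X y - G y (X y) v *\<^sub>R v) has_derivative
        (\<lambda>h. (G x v v *\<^sub>R X' h + dG x h v v *\<^sub>R X x)
          - (dG x h (X x) v + G x (X' h) v + G x (X x) 0) *\<^sub>R v)) (at x)"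
      by (intro has_derivative_diff has_derivative_scaleR dG_deriv[OF x] X has_derivative_scaleR_left
          G_deriv[where p = "\<lambda>y. y" and p' = "\<lambda>h. h"] has_derivative_ident has_derivative_const x)
    then have "((\<lambda>y. S y v v) has_derivative
        (\<lambda>h. (G x v v *\<^sub>R X' h + dG x h v v *\<^sub>R X x)
          - (dG x h (X x) v + G x (X' h) v + G x (X x) 0) *\<^sub>R v)) (at x)"
      by (rule has_derivative_transform_within_open[OF _ open_U x]) (simp add: S_diag)
    then have 1: "frechet_derivative (\<lambda>y. S y v v) (at x) u =
        (G x v v *\<^sub>R X' u + dG x u v v *\<^sub>R X x) - (dG x u (X x) v + G x (X' u) v) *\<^sub>R v"
      by (simp add: frechet_derivative_at[symmetric] bilinear_rzero[OF B])
    have 2: "dG x u v v = 2 * G x v (c v)"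
      using g_par[of u v v] sym[OF x, of v "c v"] by (simp add: c_def)
    have 3: "dG x u (X x) v = G x (c (X x)) v + G x (X x) (c v)"
      using g_par[of u "X x" v] by (simp add: c_def)
    \<comment> \<open>The two mixed terms enter as a sum, which is the polarization of the diagonal
      and so is known without a formula for S off the diagonal.\<close>
    have "S x (c v) v + S x v (c v) = S x (v + c v) (v + c v) - S x v v - S x (c v) (c v)"
      by (simp add: bilinear_ladd[OF S_bil] bilinear_radd[OF S_bil])
    then have 4: "S x (c v) v + S x v (c v)
        = (2 * G x v (c v)) *\<^sub>R X x - G x (X x) v *\<^sub>R c v - G x (X x) (c v) *\<^sub>R v"
      unfolding S_diag[OF x]
      by (simp add: bilinear_ladd[OF B] bilinear_radd[OF B] sym[OF x, of "c v" v] algebra_simps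
          flip: scaleR_2)
    have 5: "c (S x v v) = G x v v *\<^sub>R c (X x) - G x (X x) v *\<^sub>R c v"
      unfolding S_diag[OF x] by (simp add: linear_diff[OF c] linear_cmul[OF c])
    have "frechet_derivative (\<lambda>y. S y v v) (at x) u + c (S x v v)
        - (S x (c v) v + S x v (c v)) = 0"
      using S_par[of v v u] unfolding c_def by (simp add: algebra_simps)
    then show "G x v v *\<^sub>R \<eta> = G x \<eta> v *\<^sub>R v"
      unfolding 1 2 3 4 5 by (simp add: \<eta>_def bilinear_ladd[OF B] algebra_simps)
  qed
  then show ?thesis
    by (simp add: \<eta>_def c_def C_def S_X add_diff_eq)
qed

end

section \<open>Recurrent vector fields on manifolds\<close>

lemma chart_inv_simps:
  assumes "is_chart c"
  shows "p \<in> fst c \<Longrightarrow> chart_inv c (snd c p) = p"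
    and "x \<in> snd c ` fst c \<Longrightarrow> chart_inv c x \<in> fst c"
    and "x \<in> snd c ` fst c \<Longrightarrow> snd c (chart_inv c x) = x"
  using assms unfolding is_chart_def homeomorphism_def by auto

abbreviation chart_image :: "('a, 'e) chart \<Rightarrow> 'e set" where
  "chart_image c \<equiv> snd c ` fst c"

abbreviation metric_in_chart ::
  "('a, 'e) tensor02 \<Rightarrow> ('a, 'e) chart \<Rightarrow> 'e \<Rightarrow> 'e \<Rightarrow> 'e \<Rightarrow> real" where
  "metric_in_chart g c \<equiv> \<lambda>x. g c (chart_inv c x)"

lemma local_metric_chart:
  assumes "smooth_atlas A" "pseudo_riemannian_metric A g" "c \<in> A"
  shows "local_metric (chart_image c) (metric_in_chart g c)"
proof -
  have c: "is_chart c" using assms unfolding smooth_atlas_def by blast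
  show ?thesis
  proof
    show "open (chart_image c)" using c unfolding is_chart_def by blast
    show "smooth_on (chart_image c) (\<lambda>x. metric_in_chart g c x u v)" for u v
      using assms(2,3) unfolding pseudo_riemannian_metric_def tensor_field_02_def smooth_in_chart_def
      by (simp add: o_def)
    fix x assume "x \<in> chart_image c"
    then have "chart_inv c x \<in> fst c" by (rule chart_inv_simps[OF c])
    then show "bilinear (metric_in_chart g c x)"
      and "metric_in_chart g c x u v = metric_in_chart g c x v u"
      and "(\<And>v. metric_in_chart g c x u v = 0) \<Longrightarrow> u = 0" for u v
      using assms(2,3) unfolding pseudo_riemannian_metric_def tensor_field_02_def by blast+
  qed
qed

lemma coord_deriv_metric:
  assumes "local_metric (chart_image c) (metric_in_chart g c)"
  shows "coord_deriv c u (\<lambda>q. g c q v w) p = local_metric.dG (metric_in_chart g c) (snd c p) u v w"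
  unfolding coord_deriv_def local_metric.dG_def[OF assms] by (simp add: o_def)

lemma christoffel_eq_Gam:
  assumes "local_metric (chart_image c) (metric_in_chart g c)" "is_chart c" "p \<in> fst c"
  shows "christoffel g c p u v = local_metric.Gam (metric_in_chart g c) (snd c p) u v"
  unfolding christoffel_def local_metric.Gam_def[OF assms(1)] coord_deriv_metric[where c = c and g = g, OF assms(1)]
  by (simp add: chart_inv_simps[OF assms(2)] assms(3))

lemma velocity_chart_change:
  assumes atlas: "smooth_atlas A" and c: "c \<in> A" and d: "d \<in> A"
    and ev: "\<forall>\<^sub>F s in nhds t. \<sigma> s \<in> fst c"
    and v: "((snd c \<circ> \<sigma>) has_vector_derivative v) (at t)"
    and t: "\<sigma> t \<in> fst d"
  shows "((snd d \<circ> \<sigma>) has_vector_derivative jacobian c d (\<sigma> t) v) (at t)"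
proof -
  have chart: "is_chart c" using atlas c unfolding smooth_atlas_def by blast
  have "\<sigma> t \<in> fst c" using ev by (rule eventually_nhds_x_imp_x)
  then have "snd c (\<sigma> t) \<in> snd c ` (fst c \<inter> fst d)" using t by blast
  moreover have "smooth_on (snd c ` (fst c \<inter> fst d)) (snd d \<circ> chart_inv c)"
    using atlas c d unfolding smooth_atlas_def by blast
  ultimately have "((snd d \<circ> chart_inv c) has_derivative jacobian c d (\<sigma> t)) (at ((snd c \<circ> \<sigma>) t))"
    using smooth_on_differentiable frechet_derivative_works unfolding jacobian_def o_def by blast
  from has_derivative_compose[OF v[unfolded has_vector_derivative_def] this]
  have "((\<lambda>s. (snd d \<circ> chart_inv c) ((snd c \<circ> \<sigma>) s)) has_derivative
      (\<lambda>h. jacobian c d (\<sigma> t) (h *\<^sub>R v))) (at t)" .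
  moreover have "\<forall>\<^sub>F s in at t. (snd d \<circ> chart_inv c) ((snd c \<circ> \<sigma>) s) = (snd d \<circ> \<sigma>) s"
    using ev unfolding eventually_nhds_conv_at
    by (auto elim!: eventually_mono simp: chart_inv_simps[OF chart])
  ultimately have D: "((snd d \<circ> \<sigma>) has_derivative (\<lambda>h. jacobian c d (\<sigma> t) (h *\<^sub>R v))) (at t)"
    by (rule has_derivative_transform_eventually)
       (use \<open>\<sigma> t \<in> fst c\<close> in \<open>simp_all add: chart_inv_simps[OF chart]\<close>)
  have "jacobian c d (\<sigma> t) (h *\<^sub>R v) = h *\<^sub>R jacobian c d (\<sigma> t) v" for h
    using linear_cmul[OF has_derivative_linear[OF D], of h 1] by simp
  then show ?thesis using D unfolding has_vector_derivative_def by simp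
qed

text \<open>Interface between the two halves of the argument: the homogeneous structure serves to
  produce such a field, and incompleteness follows from the field and the metric.\<close>

locale recurrent_vector_field =
  fixes A :: "('a::{t2_space, second_countable_topology}, 'e::euclidean_space) chart set"
    and g :: "('a, 'e) tensor02" and \<xi> :: "('a, 'e) vfield"
  assumes atlas: "smooth_atlas A" and metric: "pseudo_riemannian_metric A g"
    and field: "vector_field A \<xi>"
    and recurrent: "c \<in> A \<Longrightarrow> p \<in> fst c \<Longrightarrow>
      coord_deriv c u (\<xi> c) p + christoffel g c p u (\<xi> c p) = g c p u (\<xi> c p) *\<^sub>R \<xi> c p"
begin

lemma chart: "c \<in> A \<Longrightarrow> is_chart c"
  using atlas unfolding smooth_atlas_def by blast

lemma field_deriv:
  assumes "c \<in> A" "p \<in> fst c"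
  shows "((\<xi> c \<circ> chart_inv c) has_derivative (\<lambda>h. coord_deriv c h (\<xi> c) p)) (at (snd c p))"
proof -
  have "smooth_on (chart_image c) (\<xi> c \<circ> chart_inv c)"
    using field assms unfolding vector_field_def smooth_in_chart_def by blast
  then show ?thesis
    using smooth_on_differentiable frechet_derivative_works assms(2)
    unfolding coord_deriv_def by blast
qed

lemma geodesic_pairing_deriv:
  assumes c: "c \<in> A"
    and ev: "\<forall>\<^sub>F s in nhds t. \<sigma> s \<in> fst c \<and> ((snd c \<circ> \<sigma>) has_vector_derivative v s) (at s)"
    and v: "(v has_vector_derivative - christoffel g c (\<sigma> t) (v t) (v t)) (at t)"
  shows "((\<lambda>s. g c (\<sigma> s) (\<xi> c (\<sigma> s)) (v s)) has_real_derivative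
    (g c (\<sigma> t) (\<xi> c (\<sigma> t)) (v t))\<^sup>2) (at t)"
proof -
  interpret local_metric "chart_image c" "metric_in_chart g c"
    by (rule local_metric_chart[OF atlas metric c])
  note inv = chart_inv_simps[OF chart[OF c]]
  have t: "\<sigma> t \<in> fst c" and x: "((snd c \<circ> \<sigma>) has_vector_derivative v t) (at t)"
    using eventually_nhds_x_imp_x[OF ev] by auto
  have X: "((\<xi> c \<circ> chart_inv c) has_derivative (\<lambda>h. coord_deriv c h (\<xi> c) (\<sigma> t)))
      (at ((snd c \<circ> \<sigma>) t))"
    using field_deriv[OF c t] by simp
  note christoffel = christoffel_eq_Gam[where c = c and g = g, OF local_metric_axioms chart[OF c] t]
  have "((\<lambda>s. metric_in_chart g c ((snd c \<circ> \<sigma>) s) ((\<xi> c \<circ> chart_inv c) ((snd c \<circ> \<sigma>) s)) (v s))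
      has_real_derivative (metric_in_chart g c ((snd c \<circ> \<sigma>) t)
        ((\<xi> c \<circ> chart_inv c) ((snd c \<circ> \<sigma>) t)) (v t))\<^sup>2) (at t)"
  proof (rule pairing_deriv[where X = "\<xi> c \<circ> chart_inv c" and x = "snd c \<circ> \<sigma>" and v = v and t = t, OF X _ x])
    show "(v has_vector_derivative - Gam ((snd c \<circ> \<sigma>) t) (v t) (v t)) (at t)"
      using v unfolding christoffel by simp
    show "coord_deriv c (v t) (\<xi> c) (\<sigma> t)
        + Gam ((snd c \<circ> \<sigma>) t) (v t) ((\<xi> c \<circ> chart_inv c) ((snd c \<circ> \<sigma>) t))
      = metric_in_chart g c ((snd c \<circ> \<sigma>) t) (v t) ((\<xi> c \<circ> chart_inv c) ((snd c \<circ> \<sigma>) t))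
        *\<^sub>R (\<xi> c \<circ> chart_inv c) ((snd c \<circ> \<sigma>) t)"
      using recurrent[OF c t, of "v t"] unfolding christoffel by (simp add: inv t)
  qed (use t in auto)
  moreover have "\<forall>\<^sub>F s in nhds t.
      metric_in_chart g c ((snd c \<circ> \<sigma>) s) ((\<xi> c \<circ> chart_inv c) ((snd c \<circ> \<sigma>) s)) (v s)
      = g c (\<sigma> s) (\<xi> c (\<sigma> s)) (v s)"
    using ev by eventually_elim (simp add: inv)
  ultimately show ?thesis
    using t by (subst (asm) DERIV_cong_ev[OF refl]) (auto simp: inv)
qed

text \<open>The Jacobian transforms the field and the velocity alike and preserves the metric. Using
  \<open>vector_derivative\<close> in \<open>d\<close> expresses the value through the curve alone,
  so charts may be chosen separately at each time.\<close>

lemma pairing_chart_change: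
  assumes c: "c \<in> A" and d: "d \<in> A"
    and ev: "\<forall>\<^sub>F s in nhds t. \<sigma> s \<in> fst c"
    and v: "((snd c \<circ> \<sigma>) has_vector_derivative v) (at t)"
    and t: "\<sigma> t \<in> fst d"
  shows "g d (\<sigma> t) (\<xi> d (\<sigma> t)) (vector_derivative (snd d \<circ> \<sigma>) (at t)) = g c (\<sigma> t) (\<xi> c (\<sigma> t)) v"
proof -
  have "\<sigma> t \<in> fst c \<inter> fst d" using eventually_nhds_x_imp_x[OF ev] t by blast
  moreover have "vector_derivative (snd d \<circ> \<sigma>) (at t) = jacobian c d (\<sigma> t) v"
    by (rule vector_derivative_at[OF velocity_chart_change[OF atlas c d ev v t]])
  moreover have "g d q (jacobian c d q a) (jacobian c d q b) = g c q a b"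
    if "q \<in> fst c \<inter> fst d" for q a b
    using c d metric that unfolding pseudo_riemannian_metric_def tensor_field_02_def by blast
  moreover have "\<xi> d q = jacobian c d q (\<xi> c q)" if "q \<in> fst c \<inter> fst d" for q
    using c d field that unfolding vector_field_def by blast
  ultimately show ?thesis by simp
qed

lemma complete_geodesic_orthogonal:
  assumes geo: "geodesic_on A g UNIV \<sigma>" and c: "c \<in> A"
    and ev: "\<forall>\<^sub>F s in nhds t. \<sigma> s \<in> fst c"
    and v: "((snd c \<circ> \<sigma>) has_vector_derivative v) (at t)"
  shows "g c (\<sigma> t) (\<xi> c (\<sigma> t)) v = 0"
proof -
  have "\<forall>t. \<exists>c v. c \<in> A
      \<and> (\<forall>\<^sub>F s in nhds t. \<sigma> s \<in> fst c \<and> ((snd c \<circ> \<sigma>) has_vector_derivative v s) (at s))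
      \<and> (v has_vector_derivative - christoffel g c (\<sigma> t) (v t) (v t)) (at t)"
    using geo unfolding geodesic_on_def by blast
  from choice[OF this] obtain ch where "\<forall>t. \<exists>v. ch t \<in> A
      \<and> (\<forall>\<^sub>F s in nhds t. \<sigma> s \<in> fst (ch t) \<and>
          ((snd (ch t) \<circ> \<sigma>) has_vector_derivative v s) (at s))
      \<and> (v has_vector_derivative - christoffel g (ch t) (\<sigma> t) (v t) (v t)) (at t)" ..
  from choice[OF this] obtain w where ch: "\<And>t. ch t \<in> A"
    and ch_ev: "\<And>t. \<forall>\<^sub>F s in nhds t. \<sigma> s \<in> fst (ch t) \<and>
        ((snd (ch t) \<circ> \<sigma>) has_vector_derivative w t s) (at s)"
    and w: "\<And>t. (w t has_vector_derivative - christoffel g (ch t) (\<sigma> t) (w t t) (w t t)) (at t)"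
    by blast
  have ch_t: "\<sigma> t \<in> fst (ch t)" for t using eventually_nhds_x_imp_x[OF ch_ev] by blast
  \<comment> \<open>The chart \<open>ch t\<close> may jump with \<open>t\<close>, and
    \<open>w t\<close> is tied to that chart; invariance makes \<open>f\<close> a single function on
    the line nevertheless.\<close>
  define f where "f t = g (ch t) (\<sigma> t) (\<xi> (ch t) (\<sigma> t))
    (vector_derivative (snd (ch t) \<circ> \<sigma>) (at t))" for t
  have f_eq: "f s = g d (\<sigma> s) (\<xi> d (\<sigma> s)) u"
    if "d \<in> A" "\<forall>\<^sub>F s in nhds s. \<sigma> s \<in> fst d" "((snd d \<circ> \<sigma>) has_vector_derivative u) (at s)"
    for d s u
    unfolding f_def by (rule pairing_chart_change[where \<sigma> = \<sigma> and t = s, OF that(1) ch that(2,3) ch_t])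
  have "(f has_real_derivative (f t)\<^sup>2) (at t)" for t
  proof -
    \<comment> \<open>To rewrite \<open>f s\<close> in the fixed chart \<open>ch t\<close>, the
      curve must stay in this chart near \<open>s\<close> and not just at \<open>s\<close>, hence
      the nested quantifier.\<close>
    have *: "\<forall>\<^sub>F s in nhds t. \<forall>\<^sub>F r in nhds s. \<sigma> r \<in> fst (ch t) \<and>
        ((snd (ch t) \<circ> \<sigma>) has_vector_derivative w t r) (at r)"
      using ch_ev[of t] by (simp only: eventually_eventually)
    have "\<forall>\<^sub>F s in nhds t. f s = g (ch t) (\<sigma> s) (\<xi> (ch t) (\<sigma> s)) (w t s)"
      using *
    proof eventually_elim
      case (elim s)
      have "\<forall>\<^sub>F r in nhds s. \<sigma> r \<in> fst (ch t)" using elim by (rule eventually_mono) simp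
      moreover have "((snd (ch t) \<circ> \<sigma>) has_vector_derivative w t s) (at s)"
        using eventually_nhds_x_imp_x[OF elim] by simp
      ultimately show ?case by (rule f_eq[OF ch])
    qed
    moreover from eventually_nhds_x_imp_x[OF this]
    have "f t = g (ch t) (\<sigma> t) (\<xi> (ch t) (\<sigma> t)) (w t t)" .
    ultimately show ?thesis
      using geodesic_pairing_deriv[OF ch ch_ev w, of t]
      by (subst DERIV_cong_ev[OF refl _ refl]) auto
  qed
  then have "f t = 0" by (rule riccati_not_global)
  then show ?thesis using f_eq[OF c ev v] by simp
qed

text \<open>Nondegeneracy gives an initial velocity that pairs nontrivially with \<xi>. The solution
  is confined to a ball in phase space, so the pairing can be kept nonzero on the whole interval by
  choosing the ball well.\<close>

lemma local_geodesic:
  assumes c: "c \<in> A" and p: "p \<in> fst c" and nz: "\<xi> c p \<noteq> 0"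
  obtains h \<gamma> v where "(h::real) > 0" "geodesic_on A g {0<..<h} \<gamma>"
    "\<And>t. t \<in> {0<..<h} \<Longrightarrow> \<gamma> t \<in> fst c"
    "\<And>t. t \<in> {0<..<h} \<Longrightarrow> ((snd c \<circ> \<gamma>) has_vector_derivative v t) (at t)"
    "\<And>t. t \<in> {0<..<h} \<Longrightarrow> g c (\<gamma> t) (\<xi> c (\<gamma> t)) (v t) \<noteq> 0"
proof -
  interpret local_metric "chart_image c" "metric_in_chart g c"
    by (rule local_metric_chart[OF atlas metric c])
  note inv = chart_inv_simps[OF chart[OF c]]
  define X where "X = \<xi> c \<circ> chart_inv c"
  define x0 where "x0 = snd c p"
  have x0: "x0 \<in> chart_image c" using p by (simp add: x0_def)
  have "X x0 \<noteq> 0" using nz p by (simp add: X_def x0_def inv)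
  then obtain u where u: "metric_in_chart g c x0 (X x0) u \<noteq> 0" using nondeg[OF x0] by blast
  let ?P = "\<lambda>y. metric_in_chart g c (fst y) (X (fst y)) (snd y)"
  \<comment> \<open>The phase points over the chart with nonzero pairing. \<open>V\<close> is open
    by continuity of the pairing, so it contains a ball around the initial data.\<close>
  define V where "V = {y \<in> chart_image c \<times> UNIV. ?P y \<noteq> 0}"
  have "continuous_on (chart_image c \<times> UNIV) ?P"
  proof (rule continuous_at_imp_continuous_on, rule ballI)
    fix y :: "'e \<times> 'e" assume y: "y \<in> chart_image c \<times> UNIV"
    then have q: "chart_inv c (fst y) \<in> fst c" and y1: "fst y \<in> chart_image c"
      using inv(2) by auto
    have X: "(X has_derivative (\<lambda>h. coord_deriv c h (\<xi> c) (chart_inv c (fst y)))) (at (fst y))"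
      using field_deriv[OF c q] inv(3)[OF y1] by (simp add: X_def)
    show "isCont ?P y"
      by (rule has_derivative_continuous)
         (rule G_deriv[OF has_derivative_fst[OF has_derivative_ident]
            has_derivative_compose[OF has_derivative_fst[OF has_derivative_ident] X]
            has_derivative_snd[OF has_derivative_ident] y1])
  qed
  then have "open ((chart_image c \<times> UNIV) \<inter> ?P -` (- {0}))"
    using open_U by (intro continuous_open_preimage open_Times) auto
  moreover have "(chart_image c \<times> UNIV) \<inter> ?P -` (- {0}) = V" unfolding V_def by auto
  ultimately have V: "open V" by simp
  have V0: "(x0, u) \<in> V" using x0 u by (simp add: V_def)
  obtain r L where r: "r > 0" "cball (x0, u) r \<subseteq> V"
    and lip: "L-lipschitz_on (cball (x0, u) r) (\<lambda>y. (snd y, - Gam (fst y) (snd y) (snd y)))"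
    using lipschitz_near_subset[OF lipschitz_near_geodesic_spray[OF x0] V V0] .
  obtain h y where h: "h > 0"
    and y: "\<And>t. t \<in> {0<..<h} \<Longrightarrow>
        (y has_vector_derivative (snd (y t), - Gam (fst (y t)) (snd (y t)) (snd (y t)))) (at t)"
    and y_in: "\<And>t. t \<in> {0<..<h} \<Longrightarrow> y t \<in> cball (x0, u) r"
    using picard_local_existence[OF lip r(1)] by metis
  define \<gamma> where "\<gamma> t = chart_inv c (fst (y t))" for t
  define v where "v t = snd (y t)" for t
  have yV: "fst (y t) \<in> chart_image c" "?P (y t) \<noteq> 0" if "t \<in> {0<..<h}" for t
    using y_in[OF that] r(2) by (auto simp: V_def)
  have \<gamma>_in: "\<gamma> t \<in> fst c" if "t \<in> {0<..<h}" for t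
    unfolding \<gamma>_def by (rule inv(2)[OF yV(1)[OF that]])
  have snd_\<gamma>: "snd c (\<gamma> t) = fst (y t)" if "t \<in> {0<..<h}" for t
    unfolding \<gamma>_def by (rule inv(3)[OF yV(1)[OF that]])
  have x_deriv: "((snd c \<circ> \<gamma>) has_vector_derivative v t) (at t)" if t: "t \<in> {0<..<h}" for t
  proof (rule has_vector_derivative_transform_within_open[where S = "{0<..<h}"])
    show "((\<lambda>s. fst (y s)) has_vector_derivative v t) (at t)"
      using bounded_linear.has_vector_derivative[OF bounded_linear_fst y[OF t]]
      by (simp add: v_def)
  qed (use t snd_\<gamma> in auto)
  have v_deriv: "(v has_vector_derivative - christoffel g c (\<gamma> t) (v t) (v t)) (at t)"
    if t: "t \<in> {0<..<h}" for t
    using bounded_linear.has_vector_derivative[OF bounded_linear_snd y[OF t]]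
    by (simp add: v_def[abs_def] christoffel_eq_Gam[where c = c and g = g, OF local_metric_axioms chart[OF c] \<gamma>_in[OF t]]
        snd_\<gamma>[OF t])
  show thesis
  proof (rule that[OF h _ \<gamma>_in x_deriv])
    show "geodesic_on A g {0<..<h} \<gamma>"
      unfolding geodesic_on_def
    proof (intro ballI bexI[OF _ c] exI conjI)
      fix t assume t: "t \<in> {0<..<h}"
      show "(v has_vector_derivative - christoffel g c (\<gamma> t) (v t) (v t)) (at t)"
        by (rule v_deriv[OF t])
      have "\<forall>\<^sub>F s in nhds t. s \<in> {0<..<h}" using t by (intro eventually_nhds_in_open) auto
      then show "\<forall>\<^sub>F s in nhds t. \<gamma> s \<in> fst c \<and> ((snd c \<circ> \<gamma>) has_vector_derivative v s) (at s)"
        by eventually_elim (intro conjI \<gamma>_in x_deriv)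
    qed
    show "g c (\<gamma> t) (\<xi> c (\<gamma> t)) (v t) \<noteq> 0" if "t \<in> {0<..<h}" for t
      using yV(2)[OF that] by (simp add: \<gamma>_def v_def X_def)
  qed
qed

theorem not_geodesically_complete:
  assumes c: "c \<in> A" and p: "p \<in> fst c" and nz: "\<xi> c p \<noteq> 0"
  shows "\<not> geodesically_complete A g"
proof
  assume complete: "geodesically_complete A g"
  obtain h \<gamma> v where h: "(h::real) > 0" and geo: "geodesic_on A g {0<..<h} \<gamma>"
    and \<gamma>: "\<And>t. t \<in> {0<..<h} \<Longrightarrow> \<gamma> t \<in> fst c"
    and v: "\<And>t. t \<in> {0<..<h} \<Longrightarrow> ((snd c \<circ> \<gamma>) has_vector_derivative v t) (at t)"
    and nz: "\<And>t. t \<in> {0<..<h} \<Longrightarrow> g c (\<gamma> t) (\<xi> c (\<gamma> t)) (v t) \<noteq> 0"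
    by (rule local_geodesic[OF c p nz]) (rule that)
  obtain \<sigma> where \<sigma>: "geodesic_on A g UNIV \<sigma>" "\<And>t. t \<in> {0<..<h} \<Longrightarrow> \<sigma> t = \<gamma> t"
  proof -
    have "open {0<..<h}" "is_interval {0<..<h}" "{0<..<h} \<noteq> {}" using h by (auto simp: is_interval_oo)
    then show ?thesis using complete geo that unfolding geodesically_complete_def by blast
  qed
  \<comment> \<open>Any interior time would do; the initial time 0 lies outside the open
    interval.\<close>
  define t where "t = h / 2"
  have t: "t \<in> {0<..<h}" using h by (simp add: t_def)
  have "\<forall>\<^sub>F s in nhds t. s \<in> {0<..<h}" using t by (intro eventually_nhds_in_open) auto
  then have "\<forall>\<^sub>F s in nhds t. \<sigma> s \<in> fst c" by eventually_elim (simp add: \<sigma> \<gamma>)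
  moreover have "((snd c \<circ> \<sigma>) has_vector_derivative v t) (at t)"
    by (rule has_vector_derivative_transform_within_open[OF v[OF t], where S = "{0<..<h}"])
       (use t \<sigma>(2) in auto)
  ultimately have "g c (\<sigma> t) (\<xi> c (\<sigma> t)) (v t) = 0"
    by (rule complete_geodesic_orthogonal[OF \<sigma>(1) c])
  then show False using nz[OF t] \<sigma>(2)[OF t] by simp
qed

end

section \<open>Degenerate structures of linear type\<close>

text \<open>Besides the diagonal, the value of S on (u,\<xi>) is needed: g(\<xi>,J\<xi>) = 0 removes
  one J term, the two multiples of J\<xi> cancel by skewness of J, and nullity of \<xi> removes the
  multiple of u. J itself serves as \<open>j\<close>, injective because its square is \<epsilon>
  times the identity with \<epsilon> nonzero.\<close>

lemma recurrent_of_linear_type: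
  assumes kaehler: "eps_kaehler_manifold \<epsilon> A g J" and \<epsilon>: "\<epsilon> \<noteq> 0"
    and hom: "homogeneous_eps_kaehler_structure A g J S"
    and lin: "linear_type \<epsilon> A g J S \<xi> \<zeta>"
    and null: "\<And>c p. c \<in> A \<Longrightarrow> p \<in> fst c \<Longrightarrow> g c p (\<xi> c p) (\<xi> c p) = 0"
    and \<zeta>: "\<And>c p. c \<in> A \<Longrightarrow> p \<in> fst c \<Longrightarrow> \<zeta> c p = (- \<epsilon> / 2) *\<^sub>R \<xi> c p"
  shows "recurrent_vector_field A g \<xi>"
proof
  show atlas: "smooth_atlas A" and metric: "pseudo_riemannian_metric A g"
    using kaehler unfolding eps_kaehler_manifold_def by blast+
  show field: "vector_field A \<xi>" using lin unfolding linear_type_def by blast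
  fix c p u assume c: "c \<in> A" and p: "p \<in> fst c"
  interpret local_metric "chart_image c" "metric_in_chart g c"
    by (rule local_metric_chart[OF atlas metric c])
  have chart: "is_chart c" using atlas c unfolding smooth_atlas_def by blast
  note inv = chart_inv_simps[OF chart]
  have bil_q: "bilinear (g c q)" and sym_q: "g c q v w = g c q w v" if "q \<in> fst c" for q v w
    using metric c that unfolding pseudo_riemannian_metric_def tensor_field_02_def by blast+
  have skew: "g c q (J c q v) w = - g c q v (J c q w)"
    and J2: "J c q (J c q v) = \<epsilon> *\<^sub>R v" and J_lin: "linear (J c q)" if "q \<in> fst c" for q v w
    using kaehler c that unfolding eps_kaehler_manifold_def tensor_field_11_def by blast+
  have J_orth: "g c q v (J c q v) = 0" if "q \<in> fst c" for q v
    using skew[OF that, of v v] sym_q[OF that, of v "J c q v"] by simp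
  have S: "S c q v w = g c q v w *\<^sub>R \<xi> c q - g c q (\<xi> c q) w *\<^sub>R v
      + (\<epsilon> * g c q v (J c q w)) *\<^sub>R J c q (\<xi> c q)
      - (\<epsilon> * g c q (\<xi> c q) (J c q w)) *\<^sub>R J c q v
      + (\<epsilon> * g c q (\<xi> c q) (J c q v)) *\<^sub>R J c q w" if q: "q \<in> fst c" for q v w
  proof -
    have "2 * g c q (\<zeta> c q) (J c q v) = - (\<epsilon> * g c q (\<xi> c q) (J c q v))"
      unfolding \<zeta>[OF c q] by (simp only: bilinear_lmul[OF bil_q[OF q]]) simp
    moreover have "S c q v w = g c q v w *\<^sub>R \<xi> c q - g c q (\<xi> c q) w *\<^sub>R v
      + (\<epsilon> * g c q v (J c q w)) *\<^sub>R J c q (\<xi> c q)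
      - (\<epsilon> * g c q (\<xi> c q) (J c q w)) *\<^sub>R J c q v
      - (2 * g c q (\<zeta> c q) (J c q v)) *\<^sub>R J c q w"
      using lin c q unfolding linear_type_def by blast
    ultimately show ?thesis by simp
  qed
  define C where "C = (\<lambda>u v. christoffel g c p u v - S c p u v)"
  have par: "coord_deriv c u (\<lambda>q. g c q v w) p - g c p (C u v) w - g c p v (C u w) = 0"
      "coord_deriv c u (\<lambda>q. S c q v w) p + C u (S c p v w) - S c p (C u v) w - S c p v (C u w) = 0"
    and S_bil: "bilinear (S c p)" for u v w
    using hom c p
    unfolding homogeneous_eps_kaehler_structure_def parallel_02_def parallel_12_def
      tensor_field_12_def Let_def C_def by blast+
  have christoffel: "christoffel g c p u v = Gam (snd c p) u v" for u v
    by (rule christoffel_eq_Gam[where c = c and g = g, OF local_metric_axioms chart p])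
  have "(\<lambda>h. coord_deriv c h (\<xi> c) p) u + Gam (snd c p) u ((\<xi> c \<circ> chart_inv c) (snd c p))
    = metric_in_chart g c (snd c p) u ((\<xi> c \<circ> chart_inv c) (snd c p))
      *\<^sub>R (\<xi> c \<circ> chart_inv c) (snd c p)"
  proof (rule recurrent_of_parallel[where S = "\<lambda>y. S c (chart_inv c y)" and j = "J c p"])
    show "snd c p \<in> chart_image c" using p by blast
    have "smooth_on (chart_image c) (\<xi> c \<circ> chart_inv c)"
      using field c unfolding vector_field_def smooth_in_chart_def by blast
    then show "((\<xi> c \<circ> chart_inv c) has_derivative (\<lambda>h. coord_deriv c h (\<xi> c) p)) (at (snd c p))"
      using smooth_on_differentiable frechet_derivative_works p
      unfolding coord_deriv_def by blast
    show "bilinear (S c (chart_inv c (snd c p)))" using S_bil by (simp add: inv p)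
    show "S c (chart_inv c y) v v = metric_in_chart g c y v v *\<^sub>R (\<xi> c \<circ> chart_inv c) y
        - metric_in_chart g c y ((\<xi> c \<circ> chart_inv c) y) v *\<^sub>R v" if "y \<in> chart_image c" for y v
      using inv(2)[OF that] by (simp add: S J_orth)
    show "S c (chart_inv c (snd c p)) u ((\<xi> c \<circ> chart_inv c) (snd c p))
      = metric_in_chart g c (snd c p) u ((\<xi> c \<circ> chart_inv c) (snd c p))
        *\<^sub>R (\<xi> c \<circ> chart_inv c) (snd c p)" for u
      using skew[OF p, of u "\<xi> c p"] sym_q[OF p, of "\<xi> c p" "J c p u"]
      by (simp add: inv p S J_orth null[OF c p])
    have C_eq: "Gam (snd c p) u v - S c (chart_inv c (snd c p)) u v = C u v" for u v
      by (simp add: C_def christoffel inv p)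
    show "dG (snd c p) u v w
        - metric_in_chart g c (snd c p) (Gam (snd c p) u v - S c (chart_inv c (snd c p)) u v) w
        - metric_in_chart g c (snd c p) v (Gam (snd c p) u w - S c (chart_inv c (snd c p)) u w) = 0"
      for u v w
      unfolding C_eq using par(1)[of u v w]
      by (simp add: coord_deriv_metric[where c = c and g = g, OF local_metric_axioms] inv p)
    show "frechet_derivative (\<lambda>y. S c (chart_inv c y) v w) (at (snd c p)) u
        + (Gam (snd c p) u (S c (chart_inv c (snd c p)) v w)
          - S c (chart_inv c (snd c p)) u (S c (chart_inv c (snd c p)) v w))
        - S c (chart_inv c (snd c p)) (Gam (snd c p) u v - S c (chart_inv c (snd c p)) u v) w
        - S c (chart_inv c (snd c p)) v (Gam (snd c p) u w - S c (chart_inv c (snd c p)) u w) = 0"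
      for u v w
      unfolding C_eq using par(2)[of u v w]
      by (simp add: coord_deriv_def o_def inv p)
    show "metric_in_chart g c (snd c p) (J c p v) v = 0" for v
      using J_orth[OF p, of v] sym_q[OF p, of v "J c p v"] by (simp add: inv p)
    show "v = 0" if "J c p v = 0" for v
      using J2[OF p, of v] \<epsilon> that linear_0[OF J_lin[OF p]] by simp
  qed
  then show "coord_deriv c u (\<xi> c) p + christoffel g c p u (\<xi> c p)
      = g c p u (\<xi> c p) *\<^sub>R \<xi> c p"
    by (simp add: christoffel inv p)
qed

theorem corollary5p2:
  fixes \<epsilon> :: real and n :: nat
    and A :: "('a::{t2_space, second_countable_topology}, 'e::euclidean_space) chart set"
    and g :: "('a, 'e) tensor02" and J :: "('a, 'e) tensor11"
  assumes "\<epsilon> \<in> {-1, 1}"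
    and "eps_kaehler_manifold \<epsilon> A g J"
    and "DIM('e) = 2 * n + 4"
    and "connected (UNIV :: 'a set)"
    and "simply_connected (UNIV :: 'a set)"
    and "\<not> flat A g"
    and "\<exists>S \<xi> \<zeta>. homogeneous_eps_kaehler_structure A g J S \<and>
           linear_type \<epsilon> A g J S \<xi> \<zeta> \<and> degenerate A g \<xi> \<and>
           (\<forall>c\<in>A. \<forall>p\<in>fst c. \<zeta> c p = (- \<epsilon> / 2) *\<^sub>R \<xi> c p)"
  shows "\<not> geodesically_complete A g"
proof -
  obtain S \<xi> \<zeta> where hom: "homogeneous_eps_kaehler_structure A g J S"
    and lin: "linear_type \<epsilon> A g J S \<xi> \<zeta>" and deg: "degenerate A g \<xi>"
    and \<zeta>: "\<And>c p. c \<in> A \<Longrightarrow> p \<in> fst c \<Longrightarrow> \<zeta> c p = (- \<epsilon> / 2) *\<^sub>R \<xi> c p"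
    using assms(7) by blast
  have null: "g c p (\<xi> c p) (\<xi> c p) = 0" if "c \<in> A" "p \<in> fst c" for c p
    using deg that unfolding degenerate_def by blast
  \<comment> \<open>One point with nonzero \<xi> suffices, as the incomplete geodesic is built from
    initial data there.\<close>
  obtain c p where "c \<in> A" "p \<in> fst c" "\<xi> c p \<noteq> 0"
    using deg unfolding degenerate_def by blast
  moreover have "\<epsilon> \<noteq> 0" using assms(1) by auto
  ultimately show ?thesis
    using recurrent_vector_field.not_geodesically_complete
      recurrent_of_linear_type[OF assms(2) _ hom lin null \<zeta>] by blast
qed

end
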